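(* Suppose $\Gamma_A=\Gamma_B=\varnothing$ (in particular all eigenvalues of $A$ and of $B$ are simple). Put $$x_0:=-\infty,\quad x_{2n}:=\infty,\quad x_{2j-1}:=\alpha_j,\quad x_{2k}:=\widehat\alpha_k,$$ $$y_0:=-\infty,\quad y_{2n}:=\infty,\quad y_{2j-1}:=\beta_j,\quad y_{2k}:=\widehat\beta_k,$$ for $j=1,\dots,n$, $k=1,\dots,n-1$, and let $R_{p,q}:=(x_{p-1},x_p)\times(y_{q-1},y_q)$ for $p,q=1,\dots,2n$. Then all the real pair-eigenvalues $(\alpha,\beta)$ of $M$ lie on a family of curves $(\alpha,\beta(\alpha))$ with the following properties: (a) each curve may pass only through rectangles $R_{p,q}$ with $p+q$ even; (b) each curve may cross from rectangle to rectangle only through the corner points $(x_i,y_j)$ with $i+j$ odd; (c) each curve $\beta(\alpha)$ is continuous in $\alpha$ except at eigenvalues of $A$; at each eigenvalue $\alpha_i\in\operatorname{Spec}(A)$ exactly one curve blows up, in the sense that $\beta(\alpha)\to+\infty$ as $\alpha\to\alpha_i+0$ and $\beta(\alpha)\to-\infty$ as $\alpha\to\alpha_i-0$; (d) each curve $\beta(\alpha)$ is monotone decreasing in $\alpha$ on its domain of continuity; more precisely, $$\frac{d\beta}{d\alpha}=-\kappa^2\,\frac{\langle (A-\alpha)^{-2}\mathbf z,\mathbf z\rangle\,\bigl(\langle (B-\beta)^{-1}\mathbf z,\mathbf z\rangle\bigr)^2}{\langle (B-\beta)^{-2}\mathbf z,\mathbf z\rangle}<0,$$ the formula being understood at points with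 $\alpha\notin\operatorname{Spec}(A)$, $\beta\notin\operatorname{Spec}(B)$.
   Context: $\mathcal H$ is a Hilbert space with $\dim\mathcal H=n<\infty$. $A,B$ are self-adjoint operators on $\mathcal H$ with eigenvalues (with multiplicity) $\alpha_1\le\dots\le\alpha_n$ and $\beta_1\le\dots\le\beta_n$. $\mathbf z\in\mathcal H$ with $\|\mathbf z\|=1$, $Z=\mathrm{Span}\{\mathbf z\}$, $P$ is the orthogonal projection onto $Z$, $Q=I-P$, and $\kappa\in\mathbb R$, $\kappa\ne0$. A pair $(\alpha,\beta)\in\mathbb C^2$ is a pair-eigenvalue of $M$ if there is a non-zero $(\mathbf u,\mathbf v)\in\mathcal H\oplus\mathcal H$ with $(A-\alpha)\mathbf u+\kappa P\mathbf v=\mathbf 0$ and $\kappa P\mathbf u+(B-\beta)\mathbf v=\mathbf 0$; it is a real pair-eigenvalue if $\alpha,\beta\in\mathbb R$. For a self-adjoint operator $X$ on $\mathcal H$, $\Phi_{X,\lambda}$ is the eigenspace for the eigenvalue $\lambda$, and $\Gamma_X:=\{\lambda\in\operatorname{Spec}(X): \exists\,\boldsymbol\varphi\in\Phi_{X,\lambda},\ \boldsymbol\varphi\ne0,\ \langle\mathbf z,\boldsymbol\varphi\rangle=0\}$. $X_{\bot,\bot}:=QX|_{Z^\bot}:Z^\bot\to Z^\bot$. The eigenvalues of $A_{\bot,\bot}$ and $B_{\bot,\bot}$ (with multiplicity) are $\widehat\alpha_1\le\dots\le\widehat\alpha_{n-1}$ and $\widehat\beta_1\le\dots\le\widehat\beta_{n-1}$.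 For $\alpha\notin\operatorname{Spec}(A)$, $(\alpha,\beta)$ is a pair-eigenvalue if and only if $\beta$ is an eigenvalue of $B-\kappa^2P(A-\alpha)^{-1}P$. The (distinct) curves $(\alpha,\beta(\alpha))$, $\alpha$ real, are formed by real pair-eigenvalues: they are the branches of these eigenvalues as $\alpha$ varies, extended by continuity to those eigenvalues of $A$ at which the branch has a finite limit; the branch going to $-\infty$ on the left of an eigenvalue of $A$ and the branch coming from $+\infty$ on its right are regarded as one curve. *)

theory Defs
  imports "HOL-Analysis.Analysis"
begin

section \<open>Complex Hilbert spaces\<close>

text \<open>The inner product is linear in its first argument.\<close>

class complex_hilbert = banach +
  fixes scaleC :: "complex \<Rightarrow> 'a \<Rightarrow> 'a" (infixr "*\<^sub>C" 75)
    and cinner :: "'a \<Rightarrow> 'a \<Rightarrow> complex"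
  assumes scaleC_add_right: "a *\<^sub>C (x + y) = a *\<^sub>C x + a *\<^sub>C y"
    and scaleC_add_left: "(a + b) *\<^sub>C x = a *\<^sub>C x + b *\<^sub>C x"
    and scaleC_scaleC: "a *\<^sub>C (b *\<^sub>C x) = (a * b) *\<^sub>C x"
    and scaleC_of_real: "complex_of_real r *\<^sub>C x = r *\<^sub>R x"
    and cinner_add_left: "cinner (x + y) w = cinner x w + cinner y w"
    and cinner_scaleC_left: "cinner (a *\<^sub>C x) w = a * cinner x w"
    and cinner_commute: "cinner x y = cnj (cinner y x)"
    and cinner_self: "cinner x x = complex_of_real ((norm x)\<^sup>2)"

global_interpretation complex_vs: vector_space "scaleC :: complex \<Rightarrow> 'a \<Rightarrow> 'a::complex_hilbert"
proof
  fix x :: 'a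
  show "1 *\<^sub>C x = x"
    using scaleC_of_real[of 1 x] by simp
qed (simp_all add: scaleC_add_right scaleC_add_left scaleC_scaleC)

abbreviation cspan :: "'a::complex_hilbert set \<Rightarrow> 'a set"
  where "cspan \<equiv> module.span scaleC"

abbreviation cdim :: "'a::complex_hilbert set \<Rightarrow> nat"
  where "cdim \<equiv> vector_space.dim scaleC"

abbreviation clinear :: "('a::complex_hilbert \<Rightarrow> 'a) \<Rightarrow> bool"
  where "clinear \<equiv> Vector_Spaces.linear scaleC scaleC"

definition selfadjoint :: "('a::complex_hilbert \<Rightarrow> 'a) \<Rightarrow> bool"
  where "selfadjoint X \<longleftrightarrow> clinear X \<and> (\<forall>u v. cinner (X u) v = cinner u (X v))"

definition orth_proj :: "'a::complex_hilbert set \<Rightarrow> 'a \<Rightarrow> 'a"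
  where "orth_proj S u = (THE p. p \<in> S \<and> (\<forall>s\<in>S. cinner (u - p) s = 0))"

definition orth_compl :: "'a::complex_hilbert set \<Rightarrow> 'a set"
  where "orth_compl S = {u. \<forall>s\<in>S. cinner u s = 0}"


section \<open>Spectra\<close>

text \<open>In \<open>eigenspace V X l\<close> the operator \<open>X\<close> is regarded as acting on the subspace \<open>V\<close>.\<close>

definition eigenspace :: "'a::complex_hilbert set \<Rightarrow> ('a \<Rightarrow> 'a) \<Rightarrow> complex \<Rightarrow> 'a set"
  where "eigenspace V X l = {u \<in> V. X u = l *\<^sub>C u}"

definition Spec :: "('a::complex_hilbert \<Rightarrow> 'a) \<Rightarrow> complex set"
  where "Spec X = {l. \<exists>u. u \<noteq> 0 \<and> u \<in> eigenspace UNIV X l}"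

text \<open>The family \<open>(e i)\<close>, \<open>i \<in> I\<close>, consists of the eigenvalues of \<open>X\<close> on \<open>V\<close>, each repeated
  according to its multiplicity. It is only used for self-adjoint \<open>X\<close>, so that geometric and
  algebraic multiplicities agree. Taking \<open>l\<close> complex forces all eigenvalues to be real.\<close>

definition enumerates_eigenvalues ::
    "'a::complex_hilbert set \<Rightarrow> ('a \<Rightarrow> 'a) \<Rightarrow> 'i set \<Rightarrow> ('i \<Rightarrow> real) \<Rightarrow> bool"
  where "enumerates_eigenvalues V X I e \<longleftrightarrow>
    (\<forall>l. card {i \<in> I. complex_of_real (e i) = l} = cdim (eigenspace V X l))"

definition ordered_eigenvalues ::
    "'a::complex_hilbert set \<Rightarrow> ('a \<Rightarrow> 'a) \<Rightarrow> nat \<Rightarrow> (nat \<Rightarrow> real) \<Rightarrow> bool"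
  where "ordered_eigenvalues V X m e \<longleftrightarrow>
    mono_on {1..m} e \<and> enumerates_eigenvalues V X {1..m} e"

text \<open>Meaningful for \<open>a \<notin> Spec X\<close>: the inverse \<open>(X - a)\<^sup>-\<^sup>1\<close>.\<close>

definition resolvent :: "('a::complex_hilbert \<Rightarrow> 'a) \<Rightarrow> complex \<Rightarrow> 'a \<Rightarrow> 'a"
  where "resolvent X a = inv (\<lambda>u. X u - a *\<^sub>C u)"


section \<open>Two operators coupled by a rank-one projection\<close>

definition PZ :: "'a::complex_hilbert \<Rightarrow> 'a \<Rightarrow> 'a"
  where "PZ z = orth_proj (cspan {z})"

definition QZ :: "'a::complex_hilbert \<Rightarrow> 'a \<Rightarrow> 'a"
  where "QZ z u = u - PZ z u"

definition Zperp :: "'a::complex_hilbert \<Rightarrow> 'a set"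
  where "Zperp z = orth_compl (cspan {z})"

text \<open>To be used on \<open>Zperp z\<close> only.\<close>

definition compression :: "'a::complex_hilbert \<Rightarrow> ('a \<Rightarrow> 'a) \<Rightarrow> 'a \<Rightarrow> 'a"
  where "compression z X u = QZ z (X u)"

definition Gam :: "'a::complex_hilbert \<Rightarrow> ('a \<Rightarrow> 'a) \<Rightarrow> complex set"
  where "Gam z X = {l \<in> Spec X. \<exists>\<phi> \<in> eigenspace UNIV X l. \<phi> \<noteq> 0 \<and> cinner z \<phi> = 0}"

definition pair_eigenvalue ::
    "('a::complex_hilbert \<Rightarrow> 'a) \<Rightarrow> ('a \<Rightarrow> 'a) \<Rightarrow> 'a \<Rightarrow> real \<Rightarrow> complex \<times> complex \<Rightarrow> bool"
  where "pair_eigenvalue A B z \<kappa> = (\<lambda>(a, b). \<exists>u v. (u, v) \<noteq> (0, 0) \<and>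
    (A u - a *\<^sub>C u) + complex_of_real \<kappa> *\<^sub>C PZ z v = 0 \<and>
    complex_of_real \<kappa> *\<^sub>C PZ z u + (B v - b *\<^sub>C v) = 0)"

text \<open>The operator \<open>B - \<kappa>\<^sup>2 P (A - a)\<^sup>-\<^sup>1 P\<close>.\<close>

definition schur_operator ::
    "('a::complex_hilbert \<Rightarrow> 'a) \<Rightarrow> ('a \<Rightarrow> 'a) \<Rightarrow> 'a \<Rightarrow> real \<Rightarrow> complex \<Rightarrow> 'a \<Rightarrow> 'a"
  where "schur_operator A B z \<kappa> a u =
    B u - complex_of_real (\<kappa>\<^sup>2) *\<^sub>C PZ z (resolvent A a (PZ z u))"


section \<open>Eigenvalue curves\<close>

text \<open>The \<open>c\<close>-th curve is the graph of \<open>b c\<close> over the set \<open>D c\<close> of reals; values of \<open>b c\<close> outside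
  \<open>D c\<close> are irrelevant. The clauses say: off \<open>Spec A\<close> the curves run through the eigenvalues of
  the operator above, with multiplicity; they are continuous; a branch with a finite one-sided
  limit at a point of \<open>Spec A\<close> is extended there by continuity (\<open>continuous_on\<close> then makes that
  limit two-sided); a branch tending to \<open>-\<infinity>\<close> on the left of a point of \<open>Spec A\<close> and
  one coming from \<open>+\<infinity>\<close> on its right belong to the same curve.\<close>

definition eigenvalue_curves ::
    "('a::complex_hilbert \<Rightarrow> 'a) \<Rightarrow> ('a \<Rightarrow> 'a) \<Rightarrow> 'a \<Rightarrow> real \<Rightarrow> nat \<Rightarrow>
      (nat \<Rightarrow> real set) \<Rightarrow> (nat \<Rightarrow> real \<Rightarrow> real) \<Rightarrow> bool"
  where "eigenvalue_curves A B z \<kappa> n D b \<longleftrightarrow>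
    (\<forall>a. complex_of_real a \<notin> Spec A \<longrightarrow>
       (\<forall>c\<in>{1..n}. a \<in> D c) \<and>
       enumerates_eigenvalues UNIV (schur_operator A B z \<kappa> (complex_of_real a)) {1..n} (\<lambda>c. b c a)) \<and>
    (\<forall>c\<in>{1..n}. continuous_on (D c) (b c) \<and>
       (\<forall>a. complex_of_real a \<in> Spec A \<longrightarrow>
          (\<forall>l. (b c \<longlongrightarrow> l) (at_left a) \<or> (b c \<longlongrightarrow> l) (at_right a) \<longrightarrow>
             a \<in> D c \<and> b c a = l) \<and>
          (filterlim (b c) at_bot (at_left a) \<longleftrightarrow> filterlim (b c) at_top (at_right a))))"

definition curve :: "real set \<Rightarrow> (real \<Rightarrow> real) \<Rightarrow> (real \<times> real) set"
  where "curve S f = {(a, f a) | a. a \<in> S}"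

definition blows_up_at :: "(real \<Rightarrow> real) \<Rightarrow> real \<Rightarrow> bool"
  where "blows_up_at f a \<longleftrightarrow>
    filterlim f at_top (at_right a) \<and> filterlim f at_bot (at_left a)"

text \<open>The grid \<open>-\<infinity>, e 1, h 1, e 2, \<dots>, h (n - 1), e n, \<infinity>\<close>, indexed by \<open>0, \<dots>, 2 * n\<close>.\<close>

definition grid :: "nat \<Rightarrow> (nat \<Rightarrow> real) \<Rightarrow> (nat \<Rightarrow> real) \<Rightarrow> nat \<Rightarrow> ereal"
  where "grid n e h i =
    (if i = 0 then -\<infinity> else if i = 2 * n then \<infinity>
     else if odd i then ereal (e ((i + 1) div 2)) else ereal (h (i div 2)))"

definition rectangle :: "(nat \<Rightarrow> ereal) \<Rightarrow> (nat \<Rightarrow> ereal) \<Rightarrow> nat \<Rightarrow> nat \<Rightarrow> (real \<times> real) set"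
  where "rectangle x y p q =
    {(s, t). x (p - 1) < ereal s \<and> ereal s < x p \<and> y (q - 1) < ereal t \<and> ereal t < y q}"

definition slope ::
    "('a::complex_hilbert \<Rightarrow> 'a) \<Rightarrow> ('a \<Rightarrow> 'a) \<Rightarrow> 'a \<Rightarrow> real \<Rightarrow> complex \<Rightarrow> complex \<Rightarrow> complex"
  where "slope A B z \<kappa> a b =
    - complex_of_real (\<kappa>\<^sup>2) *
      (cinner (resolvent A a (resolvent A a z)) z * (cinner (resolvent B b z) z)\<^sup>2)
      / cinner (resolvent B b (resolvent B b z)) z"

end

theory Submission
  imports Defs
begin

text \<open>Put \<open>H = Z \<oplus> Z\<^sup>\<bottom>\<close> and diagonalise the compression of a self-adjoint operator \<open>X\<close> to \<open>Z\<^sup>\<bottom>\<close>, with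
orthonormal eigenvectors \<open>\<psi> k\<close> and eigenvalues \<open>h k\<close>. In the basis \<open>z, \<psi> 1, \<dots>, \<psi> m\<close> the operator
\<open>X\<close> is a diagonal matrix bordered by one row and one column, with border entries \<open>\<sigma> k = \<langle>X \<psi>\<^sub>k, z\<rangle>\<close>.
Gaussian elimination in \<open>(X - \<lambda>) u = \<tau> z\<close> leaves a single scalar equation \<open>\<xi> G(\<lambda>) = \<tau>\<close> for
\<open>\<xi> = \<langle>u, z\<rangle>\<close>, where
\<open>G(\<lambda>) = \<langle>X z, z\<rangle> - \<lambda> - (\<Sum>k. |\<sigma> k|\<^sup>2 / (h k - \<lambda>))\<close>, and at a pole \<open>\<lambda> = h k\<close> it leaves \<open>\<xi> = 0\<close>
(lemma \<open>response\<close>). The hypothesis \<open>\<Gamma> = \<emptyset>\<close> implies that \<open>u\<close> is determined by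
\<open>\<xi>\<close> and \<open>\<tau>\<close>, that the \<open>h k\<close> are distinct, and that no \<open>\<sigma> k\<close> vanishes. So the function \<open>G\<close> knows
everything: the eigenvalues of \<open>X\<close> are its zeros, \<open>\<langle>(X - \<lambda>)\<^sup>-\<^sup>1 z, z\<rangle> = 1 / G(\<lambda>)\<close>,
\<open>\<langle>(X - \<lambda>)\<^sup>-\<^sup>2 z, z\<rangle> = - G'(\<lambda>) / G(\<lambda>)\<^sup>2\<close>, and the eigenvalues of \<open>X - t P\<close> are the solutions of
\<open>G(\<lambda>) = t\<close>, all of them simple.

On each of the \<open>n = m + 1\<close> intervals into which the poles divide the line, \<open>G\<close> decreases from \<open>+\<infinity>\<close> to \<open>-\<infinity>\<close>. Hence
its zeros interlace with its poles, which is the order of the grid points, and the sign of \<open>G\<close>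
alternates from one grid interval to the next. Let \<open>F\<close> and \<open>G\<close> be the functions of \<open>A\<close> and \<open>B\<close>.
A real pair \<open>(s, t)\<close> is a pair-eigenvalue exactly if \<open>F(s) G(t) = \<kappa>\<^sup>2\<close>, or one of \<open>s, t\<close> is a pole and
the other is a zero (\<open>pair_eigenvalue_iff\<close>). Since \<open>\<kappa>\<^sup>2 > 0\<close>, the first alternative forces equal
signs, which is (a), and the second one describes the corners in (b).

For (c), invert \<open>G\<close> on its \<open>n\<close> intervals: this gives \<open>n\<close> decreasing branches, and away from \<open>Spec A\<close>
the eigenvalue curves consist of the branches evaluated at \<open>t = \<kappa>\<^sup>2 / F(s)\<close>. Between two eigenvalues
of \<open>A\<close> this \<open>t\<close> increases from \<open>-\<infinity>\<close> to \<open>+\<infinity>\<close>, passing continuously through \<open>0\<close> at the pole of \<open>F\<close>. So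
at an eigenvalue of \<open>A\<close> branch \<open>k\<close> arrives at the left end of its interval, where branch \<open>k - 1\<close> starts
on the other side; only branch \<open>0\<close> escapes to \<open>-\<infinity>\<close> and is continued by the top branch. Conversely, let
an arbitrary family of curves be given. Off \<open>Spec A\<close> its values avoid the poles of \<open>G\<close>, so connectedness
keeps each curve on one branch throughout each interval of the complement of \<open>Spec A\<close>, and since
eigenvalues are simple the curves and the branches are in bijection there (\<open>label_bij\<close>). The curve
on branch \<open>0\<close> is the one that blows up; the others extend. Part (d) is the chain rule together with the
two resolvent formulas, and monotonicity across the eigenvalues of \<open>A\<close> follows from continuity.\<close>

section \<open>The intervals between finitely many points\<close>

text \<open>The same intervals are needed with the poles and with the zeros of a function as division points, so
they are indexed by position: \<open>k = 0\<close> is the unbounded interval on the left and \<open>k = m\<close> the one on the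
right.\<close>

definition cell :: "nat \<Rightarrow> (nat \<Rightarrow> real) \<Rightarrow> nat \<Rightarrow> real set"
  where "cell m h k = {x. (0 < k \<longrightarrow> h k < x) \<and> (k < m \<longrightarrow> x < h (Suc k))}"

lemma open_cell: "open (cell m h k)"
proof -
  have "cell m h k = (if 0 < k then {h k<..} else UNIV) \<inter> (if k < m then {..<h (Suc k)} else UNIV)"
    by (auto simp: cell_def)
  then show ?thesis by auto
qed

lemma convex_cell: "x \<in> cell m h k \<Longrightarrow> y \<in> cell m h k \<Longrightarrow> x \<le> t \<Longrightarrow> t \<le> y \<Longrightarrow> t \<in> cell m h k"
  by (auto simp: cell_def)

lemma connected_cell: "connected (cell m h k)"
  unfolding is_interval_connected_1[symmetric] is_interval_1 using convex_cell by blast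

text \<open>The index is the largest \<open>k\<close> for which \<open>h k\<close> lies to the left of the point.\<close>

lemma cell_cover:
  assumes "x \<notin> h ` {1..m}"
  obtains k where "k \<le> m" "x \<in> cell m h k"
proof -
  define P where "P k \<longleftrightarrow> k \<le> m \<and> (0 < k \<longrightarrow> h k < x)" for k
  define k where "k = Greatest P"
  have P0: "P 0" by (simp add: P_def)
  have b: "\<forall>y. P y \<longrightarrow> y \<le> m" by (simp add: P_def)
  have Pk: "P k" unfolding k_def by (rule GreatestI_nat[of P 0 m]) (use P0 b in blast)+
  have "x < h (Suc k)" if "k < m"
  proof (rule ccontr)
    assume "\<not> x < h (Suc k)"
    moreover have "x \<noteq> h (Suc k)" using assms that by auto
    ultimately have "P (Suc k)" using that by (auto simp: P_def)
    then have "Suc k \<le> Greatest P" by (rule Greatest_le_nat) (use b in blast)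
    then have "Suc k \<le> k" by (simp add: k_def)
    then show False by simp
  qed
  then show thesis using that[of k] Pk by (auto simp: P_def cell_def)
qed

lemma cell_less:
  assumes "strict_mono_on {1..m} h" "k < k'" "k' \<le> m" "x \<in> cell m h k" "y \<in> cell m h k'"
  shows "x < h (Suc k)" "h (Suc k) < y"
proof -
  show "x < h (Suc k)" using assms by (simp add: cell_def)
  have "h (Suc k) \<le> h k'"
  proof (cases "Suc k = k'")
    case False
    then show ?thesis using assms by (intro less_imp_le strict_mono_onD[OF assms(1)]) auto
  qed simp
  then show "h (Suc k) < y" using assms by (auto simp: cell_def)
qed

lemma cell_unique:
  assumes "strict_mono_on {1..m} h" "k \<le> m" "k' \<le> m" "x \<in> cell m h k" "x \<in> cell m h k'"
  shows "k = k'"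
  using cell_less[OF assms(1), of k k' x x] cell_less[OF assms(1), of k' k x x] assms
  by (metis less_irrefl less_trans linorder_neqE_nat)

lemma gap_point_notin_cell:
  assumes "strict_mono_on {1..m} h" "j \<in> {1..m}" "k \<le> m"
  shows "h j \<notin> cell m h k"
proof
  assume a: "h j \<in> cell m h k"
  have mono: "h a \<le> h b" if "a \<in> {1..m}" "b \<in> {1..m}" "a \<le> b" for a b
    using that strict_mono_onD[OF assms(1), of a b] by (cases "a = b") auto
  show False
  proof (cases "j \<le> k")
    case True
    then show ?thesis using a mono[of j k] assms by (auto simp: cell_def)
  next
    case False
    then show ?thesis using a mono[of "Suc k" j] assms by (auto simp: cell_def)
  qed
qed

lemma cell_nonempty:
  assumes "strict_mono_on {1..m} h" "k \<le> m"
  shows "cell m h k \<noteq> {}"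
proof -
  have "h k < h (Suc k)" if "0 < k" "k < m"
    using that by (intro strict_mono_onD[OF assms(1)]) auto
  then have "(if 0 < k then if k < m then (h k + h (Suc k)) / 2 else h k + 1 else h (Suc k) - 1) \<in> cell m h k"
    by (auto simp: cell_def)
  then show ?thesis by blast
qed

text \<open>By the intermediate value property a connected set that meets two intervals contains a division
point between them. This is what keeps a continuous eigenvalue curve on a single branch.\<close>

lemma connected_avoid_subset_cell:
  assumes "connected S" "S \<inter> h ` {1..m} = {}" "strict_mono_on {1..m} h"
  obtains k where "k \<le> m" "S \<subseteq> cell m h k"
proof (cases "S = {}")
  case True
  then show ?thesis using that[of 0] by simp
next
  case False
  then obtain x where x: "x \<in> S" by blast
  obtain k where k: "k \<le> m" "x \<in> cell m h k" using cell_cover[of x h m] x assms(2) by blast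
  have "y \<in> cell m h k" if y: "y \<in> S" for y
  proof -
    obtain k' where k': "k' \<le> m" "y \<in> cell m h k'" using cell_cover[of y h m] y assms(2) by blast
    have i: "{p..q} \<subseteq> S" if "p \<in> S" "q \<in> S" for p q
      using connected_contains_Icc[OF assms(1) that] .
    have "k = k'"
    proof (rule ccontr)
      assume "k \<noteq> k'"
      then consider "k < k'" | "k' < k" by linarith
      then show False
      proof cases
        case 1
        then have "h (Suc k) \<in> S" using cell_less[OF assms(3) 1 k'(1) k(2) k'(2)] i[OF x y] by auto
        then show False using assms(2) 1 k' by auto
      next
        case 2
        then have "h (Suc k') \<in> S" using cell_less[OF assms(3) 2 k(1) k'(2) k(2)] i[OF y x] by auto
        then show False using assms(2) 2 k by auto
      qed
    qed
    then show ?thesis using k' by simp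
  qed
  then show ?thesis using that k by blast
qed

section \<open>Rational functions that decrease between their poles\<close>

text \<open>The negative of \<open>G\<close> below is a rational Pick function (it maps the upper half-plane to itself);
\<open>W\<close> is \<open>- G'\<close>. The values of \<open>G\<close> at its poles, where \<open>1 / 0 = 0\<close> enters, have no meaning.\<close>

locale pick_function =
  fixes m :: nat and h v :: "nat \<Rightarrow> real" and c :: real
  assumes h: "strict_mono_on {1..m} h" and v: "\<And>k. k \<in> {1..m} \<Longrightarrow> 0 < v k"
begin

definition G :: "real \<Rightarrow> real"
  where "G x = c - x - (\<Sum>k=1..m. v k / (h k - x))"

definition W :: "real \<Rightarrow> real"
  where "W x = 1 + (\<Sum>k=1..m. v k / (h k - x)\<^sup>2)"

abbreviation pole_gap :: "nat \<Rightarrow> real set" where "pole_gap \<equiv> cell m h"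

lemma W_pos: "0 < W x"
proof -
  have "0 \<le> (\<Sum>k=1..m. v k / (h k - x)\<^sup>2)"
    by (rule sum_nonneg) (use v in \<open>auto simp: less_imp_le\<close>)
  then show ?thesis by (simp add: W_def)
qed

lemma G_deriv:
  assumes "x \<notin> h ` {1..m}"
  shows "(G has_real_derivative - W x) (at x)"
proof -
  have 1: "((\<lambda>x. v k / (h k - x)) has_real_derivative v k / (h k - x)\<^sup>2) (at x)" if "k \<in> {1..m}" for k
    using assms that
    by (auto intro!: derivative_eq_intros simp: power2_eq_square)
  have "((\<lambda>x. c - x - (\<Sum>k=1..m. v k / (h k - x))) has_real_derivative
      0 - 1 - (\<Sum>k=1..m. v k / (h k - x)\<^sup>2)) (at x)"
    by (intro DERIV_diff DERIV_const DERIV_ident DERIV_sum 1)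
  then show ?thesis unfolding G_def[abs_def] W_def by simp
qed

lemma pole_gap_avoids_poles: "k \<le> m \<Longrightarrow> x \<in> pole_gap k \<Longrightarrow> x \<notin> h ` {1..m}"
  using gap_point_notin_cell[OF h] by blast

lemma G_isCont: "x \<notin> h ` {1..m} \<Longrightarrow> isCont G x"
  using G_deriv DERIV_isCont by blast

text \<open>Termwise: inside one interval \<open>h j - x\<close> and \<open>h j - y\<close> have the same sign for every \<open>j\<close>.\<close>

lemma G_less:
  assumes k: "k \<le> m" and x: "x \<in> pole_gap k" and y: "y \<in> pole_gap k" and xy: "x < y"
  shows "G y < G x"
proof -
  have "v j / (h j - x) \<le> v j / (h j - y)" if j: "j \<in> {1..m}" for j
  proof -
    have *: "0 < (h j - x) * (h j - y)"
    proof (rule ccontr)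
      assume "\<not> ?thesis"
      then have "x \<le> h j" "h j \<le> y" using xy by (auto simp: not_less mult_le_0_iff)
      then have "h j \<in> pole_gap k" using x y convex_cell by blast
      then show False using gap_point_notin_cell[OF h j k] by simp
    qed
    have "v j / (h j - y) - v j / (h j - x) = v j * (y - x) / ((h j - x) * (h j - y))"
    proof -
      have "h j - x \<noteq> 0" "h j - y \<noteq> 0" using * by auto
      then show ?thesis by (simp add: diff_frac_eq algebra_simps)
    qed
    also have "\<dots> \<ge> 0" using * v[OF j] xy by simp
    finally show ?thesis by simp
  qed
  then have "(\<Sum>k=1..m. v k / (h k - x)) \<le> (\<Sum>k=1..m. v k / (h k - y))" by (rule sum_mono)
  then show ?thesis using xy by (simp add: G_def)
qed

lemma G_less_iff:
  assumes "k \<le> m" "x \<in> pole_gap k" "y \<in> pole_gap k"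
  shows "G y < G x \<longleftrightarrow> x < y"
  using G_less[OF assms] G_less[OF assms(1,3,2)] by (metis less_irrefl less_trans linorder_neqE_linordered_idom)

lemma G_regular_part_tendsto:
  assumes j: "j \<in> {1..m}"
  shows "((\<lambda>x. c - x - (\<Sum>k\<in>{1..m}-{j}. v k / (h k - x))) \<longlongrightarrow>
     c - h j - (\<Sum>k\<in>{1..m}-{j}. v k / (h k - h j))) (at (h j) within S)"
proof -
  have "h k \<noteq> h j" if "k \<in> {1..m}-{j}" for k
    using that j strict_mono_on_imp_inj_on[OF h] by (auto dest: inj_onD)
  then show ?thesis by (intro tendsto_intros) auto
qed

text \<open>Isolates the one summand that is singular at \<open>h j\<close>.\<close>

lemma G_split: "j \<in> {1..m} \<Longrightarrow> G = (\<lambda>x. (c - x - (\<Sum>k\<in>{1..m}-{j}. v k / (h k - x))) + v j / (x - h j))"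
proof
  fix x assume j: "j \<in> {1..m}"
  have "v j / (x - h j) = - (v j / (h j - x))" by (metis minus_diff_eq minus_divide_right)
  then show "G x = (c - x - (\<Sum>k\<in>{1..m}-{j}. v k / (h k - x))) + v j / (x - h j)"
    unfolding G_def using j by (subst sum.remove[of _ j]) auto
qed

lemma G_at_right:
  assumes j: "j \<in> {1..m}" shows "filterlim G at_top (at_right (h j))"
proof -
  have "filterlim (\<lambda>x. inverse (x - h j)) at_top (at_right (h j))"
    by (rule filterlim_inverse_at_top) (auto simp: eventually_at_filter intro!: tendsto_eq_intros)
  then have "filterlim (\<lambda>x. v j * inverse (x - h j)) at_top (at_right (h j))"
    using v[OF j] by (intro filterlim_tendsto_pos_mult_at_top[OF tendsto_const]) auto
  then have *: "filterlim (\<lambda>x. v j / (x - h j)) at_top (at_right (h j))"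
    by (simp add: divide_inverse)
  show ?thesis
    by (subst G_split[OF j], rule filterlim_tendsto_add_at_top[OF G_regular_part_tendsto[OF j] *])
qed

lemma G_at_left:
  assumes j: "j \<in> {1..m}" shows "filterlim G at_bot (at_left (h j))"
proof -
  have "filterlim (\<lambda>x. inverse (x - h j)) at_bot (at_left (h j))"
    by (rule filterlim_inverse_at_bot) (auto simp: eventually_at_filter intro!: tendsto_eq_intros)
  then have "filterlim (\<lambda>x. v j * inverse (x - h j)) at_bot (at_left (h j))"
    using v[OF j] by (intro filterlim_tendsto_pos_mult_at_bot[OF tendsto_const]) auto
  then have *: "filterlim (\<lambda>x. v j / (x - h j)) at_bot (at_left (h j))"
    by (simp add: divide_inverse)
  show ?thesis
    by (subst G_split[OF j], rule iffD2[OF filterlim_tendsto_add_at_bot_iff[OF G_regular_part_tendsto[OF j]] *])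
qed

lemma G_plus_id_tendsto:
  assumes "filterlim (\<lambda>x. - x) at_infinity F"
  shows "((\<lambda>x. c - (\<Sum>k=1..m. v k / (h k - x))) \<longlongrightarrow> c - (\<Sum>k=1..m. 0)) F"
proof -
  have "((\<lambda>x. v k / (h k - x)) \<longlongrightarrow> 0) F" for k
  proof (rule tendsto_divide_0[OF tendsto_const])
    have "filterlim (\<lambda>x. h k + - x) at_infinity F"
      by (intro tendsto_add_filterlim_at_infinity[OF tendsto_const] assms)
    then show "filterlim (\<lambda>x. h k - x) at_infinity F" by simp
  qed
  then show ?thesis by (intro tendsto_intros)
qed

lemma G_at_bot: "filterlim G at_top at_bot"
proof -
  have u: "filterlim (\<lambda>x::real. - x) at_top at_bot"
    by (simp add: filterlim_uminus_at_top_at_bot)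
  have "filterlim (\<lambda>x. (c - (\<Sum>k=1..m. v k / (h k - x))) + - x) at_top at_bot"
    by (rule filterlim_tendsto_add_at_top[OF G_plus_id_tendsto])
      (use u in \<open>auto intro: filterlim_at_top_imp_at_infinity\<close>)
  then show ?thesis by (simp add: G_def[abs_def] algebra_simps)
qed

lemma G_at_top: "filterlim G at_bot at_top"
proof -
  have u: "filterlim (\<lambda>x::real. - x) at_bot at_top"
    by (simp add: filterlim_uminus_at_bot_at_top)
  then have ui: "filterlim (\<lambda>x::real. - x) at_infinity at_top"
    by (rule filterlim_mono[OF _ at_bot_le_at_infinity order_refl])
  have "filterlim (\<lambda>x. (c - (\<Sum>k=1..m. v k / (h k - x))) + - x) at_bot at_top"
    by (rule iffD2[OF filterlim_tendsto_add_at_bot_iff[OF G_plus_id_tendsto[OF ui]] u])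
  then show ?thesis by (simp add: G_def[abs_def] algebra_simps)
qed

lemma G_surj:
  assumes k: "k \<le> m"
  obtains x where "x \<in> pole_gap k" "G x = t"
proof -
  obtain x0 where x0: "x0 \<in> pole_gap k" using cell_nonempty[OF h k] by blast
  have "\<exists>x\<in>pole_gap k. t < G x"
  proof (cases "0 < k")
    case True
    then have j: "k \<in> {1..m}" using k by simp
    have "h k < x0" using x0 True by (simp add: cell_def)
    then have "\<forall>\<^sub>F x in at_right (h k). h k < x \<and> x < x0"
      using eventually_at_right_real by fastforce
    moreover have "\<forall>\<^sub>F x in at_right (h k). t < G x"
      using G_at_right[OF j] by (simp add: filterlim_at_top_dense)
    ultimately have "\<forall>\<^sub>F x in at_right (h k). x \<in> pole_gap k \<and> t < G x"
      by eventually_elim (use x0 in \<open>auto simp: cell_def\<close>)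
    then show ?thesis using eventually_happens'[OF trivial_limit_at_right_real] by blast
  next
    case False
    have "\<forall>\<^sub>F x in at_bot. t < G x" using G_at_bot by (simp add: filterlim_at_top_dense)
    moreover have "\<forall>\<^sub>F x in at_bot. x < x0" by simp
    ultimately have "\<forall>\<^sub>F x in at_bot. x \<in> pole_gap k \<and> t < G x"
      by eventually_elim (use x0 False in \<open>auto simp: cell_def\<close>)
    then show ?thesis using eventually_happens'[OF trivial_limit_at_bot_linorder] by blast
  qed
  then obtain x1 where x1: "x1 \<in> pole_gap k" "t < G x1" by blast
  have "\<exists>x\<in>pole_gap k. G x < t"
  proof (cases "k < m")
    case True
    then have j: "Suc k \<in> {1..m}" using k by simp
    have "x0 < h (Suc k)" using x0 True by (simp add: cell_def)
    then have "\<forall>\<^sub>F x in at_left (h (Suc k)). x0 < x \<and> x < h (Suc k)"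
      using eventually_at_left_real by fastforce
    moreover have "\<forall>\<^sub>F x in at_left (h (Suc k)). G x < t"
      using G_at_left[OF j] by (simp add: filterlim_at_bot_dense)
    ultimately have "\<forall>\<^sub>F x in at_left (h (Suc k)). x \<in> pole_gap k \<and> G x < t"
      by eventually_elim (use x0 in \<open>auto simp: cell_def\<close>)
    then show ?thesis using eventually_happens'[OF trivial_limit_at_left_real] by blast
  next
    case False
    have "\<forall>\<^sub>F x in at_top. G x < t" using G_at_top by (simp add: filterlim_at_bot_dense)
    moreover have "\<forall>\<^sub>F x in at_top. x0 < x" by simp
    ultimately have "\<forall>\<^sub>F x in at_top. x \<in> pole_gap k \<and> G x < t"
      by eventually_elim (use x0 False in \<open>auto simp: cell_def\<close>)
    then show ?thesis using eventually_happens'[OF trivial_limit_at_top_linorder] by blast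
  qed
  then obtain x2 where x2: "x2 \<in> pole_gap k" "G x2 < t" by blast
  have le: "x1 \<le> x2" using G_less_iff[OF k x1(1) x2(1)] x1 x2 by simp
  have "isCont G x" if "x1 \<le> x" "x \<le> x2" for x
    using convex_cell[OF x1(1) x2(1) that] pole_gap_avoids_poles[OF k] G_isCont by blast
  then obtain x where "x1 \<le> x" "x \<le> x2" "G x = t"
    using IVT2[of G x2 t x1] x1 x2 le by auto
  then show thesis using that convex_cell[OF x1(1) x2(1)] by blast
qed

text \<open>The inverse of \<open>G\<close> on its \<open>k\<close>-th interval. Since \<open>G\<close> is decreasing there, the order relations
\<open>branch_less_iff\<close> and \<open>less_branch_iff\<close> translate every statement about the position of a branch
into one about a value of \<open>G\<close>; continuity and the limits of the branches at \<open>\<plusminus>\<infinity>\<close> are obtained from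
them directly.\<close>

definition branch :: "nat \<Rightarrow> real \<Rightarrow> real"
  where "branch k t = (THE x. x \<in> pole_gap k \<and> G x = t)"

lemma branch_ex1: "k \<le> m \<Longrightarrow> \<exists>!x. x \<in> pole_gap k \<and> G x = t"
  using G_surj[of k t] G_less[of k] by (metis less_irrefl linorder_neqE_linordered_idom)

lemma branch_in: "k \<le> m \<Longrightarrow> branch k t \<in> pole_gap k"
  and G_branch: "k \<le> m \<Longrightarrow> G (branch k t) = t"
  using theI'[OF branch_ex1, of k t] unfolding branch_def by auto

lemma branch_eq: "k \<le> m \<Longrightarrow> x \<in> pole_gap k \<Longrightarrow> branch k (G x) = x"
  using branch_ex1[of k "G x"] branch_in G_branch by blast

lemma branch_less_iff:
  assumes "k \<le> m" "x \<in> pole_gap k"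
  shows "branch k t < x \<longleftrightarrow> G x < t"
  using G_less_iff[OF assms(1) branch_in[OF assms(1), of t] assms(2)] G_branch[OF assms(1), of t] by simp

lemma less_branch_iff:
  assumes "k \<le> m" "x \<in> pole_gap k"
  shows "x < branch k t \<longleftrightarrow> t < G x"
  using G_less_iff[OF assms branch_in[OF assms(1), of t]] G_branch[OF assms(1), of t] by simp

lemma branch_antimono: "k \<le> m \<Longrightarrow> s < t \<Longrightarrow> branch k t < branch k s"
  using branch_less_iff[OF _ branch_in, of k] G_branch by simp

lemma branch_inj: "k \<le> m \<Longrightarrow> k' \<le> m \<Longrightarrow> branch k t = branch k' t \<Longrightarrow> k = k'"
  using cell_unique[OF h] branch_in by metis

lemma G_eq_iff: "x \<notin> h ` {1..m} \<and> G x = t \<longleftrightarrow> (\<exists>k\<le>m. x = branch k t)"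
  using cell_cover[of x h m] branch_eq branch_in G_branch pole_gap_avoids_poles by metis

lemma branch_isCont:
  assumes k: "k \<le> m" shows "isCont (branch k) t"
  unfolding isCont_def
proof (rule order_tendstoI)
  fix y assume y: "y < branch k t"
  obtain d where d: "0 < d" "ball (branch k t) d \<subseteq> pole_gap k"
    using open_cell branch_in[OF k] open_contains_ball by metis
  obtain y' where y': "max y (branch k t - d) < y'" "y' < branch k t"
    using dense[of "max y (branch k t - d)" "branch k t"] y d by auto
  then have pole_gap: "y' \<in> pole_gap k" using d by (auto simp: dist_real_def subset_iff)
  then have "t < G y'" using less_branch_iff[OF k pole_gap] y' by simp
  then have "\<forall>\<^sub>F s in at t. s < G y'" by (rule order_tendstoD(2)[OF tendsto_ident_at])
  then show "\<forall>\<^sub>F s in at t. y < branch k s"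
    by eventually_elim (metis less_branch_iff[OF k pole_gap] y'(1) max_less_iff_conj less_trans)
next
  fix y assume y: "branch k t < y"
  obtain d where d: "0 < d" "ball (branch k t) d \<subseteq> pole_gap k"
    using open_cell branch_in[OF k] open_contains_ball by metis
  obtain y' where y': "y' < min y (branch k t + d)" "branch k t < y'"
    using dense[of "branch k t" "min y (branch k t + d)"] y d by auto
  then have pole_gap: "y' \<in> pole_gap k" using d by (auto simp: dist_real_def subset_iff)
  then have "G y' < t" using branch_less_iff[OF k pole_gap] y' by simp
  then have "\<forall>\<^sub>F s in at t. G y' < s" by (rule order_tendstoD(1)[OF tendsto_ident_at])
  then show "\<forall>\<^sub>F s in at t. branch k s < y"
    by eventually_elim (metis branch_less_iff[OF k pole_gap] y'(1) min_less_iff_conj less_trans)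
qed

lemma branch_deriv:
  assumes k: "k \<le> m"
  shows "(branch k has_real_derivative - inverse (W (branch k t))) (at t)"
proof -
  have "(branch k has_real_derivative inverse (- W (branch k t))) (at t)"
  proof (rule DERIV_inverse_function)
    show "(G has_real_derivative - W (branch k t)) (at (branch k t))"
      using G_deriv pole_gap_avoids_poles[OF k branch_in[OF k]] by blast
    show "t - 1 < t" "t < t + 1" by auto
  qed (use W_pos[of "branch k t"] G_branch[OF k] branch_isCont[OF k] in auto)
  then show ?thesis by simp
qed

text \<open>As \<open>t\<close> tends to \<open>+\<infinity>\<close>, branch \<open>k\<close> moves down to the left end of its interval, and as \<open>t\<close> tends to \<open>-\<infinity>\<close>
up to the right end; the outermost branches are unbounded there. The right end of one
interval being the left end of the next, branches link up across an infinite value of \<open>t\<close>.\<close>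

lemma branch_at_top:
  assumes k: "k \<le> m" "0 < k" shows "(branch k \<longlongrightarrow> h k) at_top"
proof (rule order_tendstoI)
  fix y assume "y < h k"
  then show "\<forall>\<^sub>F s in at_top. y < branch k s"
    using branch_in[OF k(1)] k(2) by (auto simp: cell_def intro!: always_eventually intro: less_trans)
next
  fix y assume y: "h k < y"
  define y' where "y' = min y (branch k 0)"
  then have yy: "y' \<le> y" by simp
  have "h k < branch k 0" using branch_in[OF k(1), of 0] k(2) by (simp add: cell_def)
  then have "y' \<in> pole_gap k" using y branch_in[OF k(1), of 0] unfolding y'_def by (auto simp: cell_def)
  note * = branch_less_iff[OF k(1) this]
  show "\<forall>\<^sub>F s in at_top. branch k s < y"
    using eventually_gt_at_top[of "G y'"] by eventually_elim (metis * yy less_le_trans)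
qed

lemma branch_at_bot:
  assumes k: "k < m" shows "(branch k \<longlongrightarrow> h (Suc k)) at_bot"
proof (rule order_tendstoI)
  fix y assume "h (Suc k) < y"
  then show "\<forall>\<^sub>F s in at_bot. branch k s < y"
    using branch_in[of k] k by (auto simp: cell_def intro!: always_eventually intro: less_trans)
next
  fix y assume y: "y < h (Suc k)"
  define y' where "y' = max y (branch k 0)"
  then have yy: "y \<le> y'" by simp
  have "branch k 0 < h (Suc k)" using branch_in[of k 0] k by (simp add: cell_def)
  then have "y' \<in> pole_gap k" using y branch_in[of k 0] k unfolding y'_def by (auto simp: cell_def)
  note * = less_branch_iff[OF _ this]
  show "\<forall>\<^sub>F s in at_bot. y < branch k s"
    using eventually_gt_at_bot[of "G y'"] by eventually_elim (metis * yy k less_imp_le le_less_trans)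
qed

lemma branch_0_at_top: "filterlim (branch 0) at_bot at_top"
  unfolding filterlim_at_bot
proof
  fix y
  define y' where "y' = min y (branch 0 0)"
  then have yy: "y' \<le> y" by simp
  have "y' \<in> pole_gap 0" using branch_in[of 0 0] unfolding y'_def by (auto simp: cell_def)
  note * = branch_less_iff[OF _ this]
  show "\<forall>\<^sub>F s in at_top. branch 0 s \<le> y"
    using eventually_gt_at_top[of "G y'"] by eventually_elim (metis * yy less_imp_le le0 less_le_trans)
qed

lemma branch_m_at_bot: "filterlim (branch m) at_top at_bot"
  unfolding filterlim_at_top
proof
  fix y
  define y' where "y' = max y (branch m 0)"
  then have yy: "y \<le> y'" by simp
  have "y' \<in> pole_gap m" using branch_in[of m 0] unfolding y'_def by (auto simp: cell_def)
  note * = less_branch_iff[OF _ this]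
  show "\<forall>\<^sub>F s in at_bot. y \<le> branch m s"
    using eventually_gt_at_bot[of "G y'"] by eventually_elim (metis * yy less_imp_le order_refl le_less_trans)
qed


section \<open>Zeros and the reciprocal\<close>

lemma branch_less: "k < k' \<Longrightarrow> k' \<le> m \<Longrightarrow> branch k t < branch k' t"
  using cell_less[OF h, of k k' "branch k t" "branch k' t"] branch_in by force

text \<open>Numbered from \<open>1\<close>, like the eigenvalues; the intervals between poles are numbered from \<open>0\<close>.\<close>

definition zero :: "nat \<Rightarrow> real"
  where "zero i = branch (i - 1) 0"

text \<open>The continuous extension of \<open>1 / G\<close> to the poles of \<open>G\<close>.\<close>

definition recip :: "real \<Rightarrow> real"
  where "recip x = (if x \<in> h ` {1..m} then 0 else inverse (G x))"

abbreviation zero_gap :: "nat \<Rightarrow> real set" where "zero_gap \<equiv> cell (Suc m) zero"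

lemma zero_strict_mono: "strict_mono_on {1..Suc m} zero"
  by (rule strict_mono_onI) (auto simp: zero_def intro!: branch_less)

lemma zero_in: "i \<in> {1..Suc m} \<Longrightarrow> zero i \<in> pole_gap (i - 1)"
  unfolding zero_def by (rule branch_in) auto

lemma G_zero: "i \<in> {1..Suc m} \<Longrightarrow> G (zero i) = 0"
  unfolding zero_def by (rule G_branch) auto

lemma zero_image: "zero ` {1..Suc m} = (\<lambda>k. branch k 0) ` {..m}"
proof -
  have "{1..Suc m} = Suc ` {..m}" by (simp add: image_Suc_atMost)
  then show ?thesis by (simp add: image_image zero_def del: image_Suc_atMost)
qed

text \<open>All zeros, since every interval between poles contains exactly one.\<close>

lemma zero_iff: "x \<in> zero ` {1..Suc m} \<longleftrightarrow> x \<notin> h ` {1..m} \<and> G x = 0"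
  unfolding zero_image G_eq_iff by auto

text \<open>Between two consecutive zeros \<open>G\<close> is negative up to the pole that separates them and positive after
it; the two unbounded intervals consist of one of these pieces only.\<close>

lemma zero_gap_cases:
  assumes i: "i \<le> Suc m" and x: "x \<in> zero_gap i"
  obtains (neg) "0 < i" "x \<in> pole_gap (i - 1)" "G x < 0"
    | (pole) "i \<in> {1..m}" "x = h i"
    | (pos) "i \<le> m" "x \<in> pole_gap i" "0 < G x"
proof -
  have z1: "zero i < x" "zero i \<in> pole_gap (i - 1)" if "0 < i"
    using that x i zero_in[of i] by (auto simp: cell_def)
  have z2: "x < zero (Suc i)" "zero (Suc i) \<in> pole_gap i" if "i \<le> m"
    using that x zero_in[of "Suc i"] by (auto simp: cell_def)
  consider "i \<le> m" "0 < i \<longrightarrow> h i < x" | "0 < i" "i \<le> m \<longrightarrow> x < h i" | "i \<in> {1..m}" "x = h i"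
    using i by fastforce
  then show thesis
  proof cases
    case 1
    then have "x \<in> pole_gap i" using z2 by (auto simp: cell_def)
    moreover then have "0 < G x"
      using less_branch_iff[of i x 0] 1 z2 by (simp add: zero_def)
    ultimately show thesis using 1 pos by blast
  next
    case 2
    then have "x \<in> pole_gap (i - 1)" using z1 i by (auto simp: cell_def)
    moreover then have "G x < 0"
      using branch_less_iff[of "i - 1" x 0] 2 z1 i by (simp add: zero_def)
    ultimately show thesis using 2 neg by blast
  next
    case 3
    then show thesis using pole by blast
  qed
qed

text \<open>On each side of the pole \<open>1 / G\<close> increases because \<open>G\<close> decreases without changing sign, and its values
are negative before the pole and positive after it.\<close>

lemma recip_less:
  assumes i: "i \<le> Suc m" and x: "x \<in> zero_gap i" and y: "y \<in> zero_gap i" and xy: "x < y"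
  shows "recip x < recip y"
proof -
  have r: "recip u = inverse (G u)" if "k \<le> m" "u \<in> pole_gap k" for k u
    using pole_gap_avoids_poles[OF that] by (simp add: recip_def)
  have rh: "recip (h i) = 0" if "i \<in> {1..m}" using that by (simp add: recip_def)
  have lt: "u < h i" if "i \<in> {1..m}" "u \<in> pole_gap (i - 1)" for u
    using that by (auto simp: cell_def)
  have gt: "h i < u" if "i \<in> {1..m}" "u \<in> pole_gap i" for u
    using that by (auto simp: cell_def)
  from i x show ?thesis
  proof (cases rule: zero_gap_cases)
    case neg
    have k: "i - 1 \<le> m" using i by simp
    from i y show ?thesis
    proof (cases rule: zero_gap_cases)
      case neg': neg
      have "G y < G x" using G_less[OF k neg(2) neg'(2) xy] .
      then show ?thesis using r[OF k neg(2)] r[OF k neg'(2)] neg' neg by simp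
    next
      case pole
      then show ?thesis using r[OF k neg(2)] neg rh by simp
    next
      case pos
      then show ?thesis using r[OF k neg(2)] neg r[OF pos(1,2)]
        by (metis inverse_negative_iff_negative inverse_positive_iff_positive less_trans)
    qed
  next
    case pole
    from i y show ?thesis
    proof (cases rule: zero_gap_cases)
      case neg
      then show ?thesis using lt pole xy by fastforce
    next
      case pole': pole
      then show ?thesis using pole xy by simp
    next
      case pos
      then show ?thesis using rh pole r by simp
    qed
  next
    case pos
    from i y show ?thesis
    proof (cases rule: zero_gap_cases)
      case neg
      then have "i \<in> {1..m}" using pos by simp
      then show ?thesis using lt[of y] gt[of x] neg pos xy by fastforce
    next
      case pole
      then show ?thesis using gt[of x] pos xy by fastforce
    next
      case pos': pos
      have "G y < G x" using G_less[OF pos(1,2) pos'(2) xy] .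
      then show ?thesis using r[OF pos(1,2)] r[OF pos'(1,2)] pos' by simp
    qed
  qed
qed

lemma eventually_notin_h: "\<forall>\<^sub>F y in at x within S. y \<notin> h ` {1..m}"
proof -
  have "\<forall>\<^sub>F y in at x. y \<notin> h ` {1..m}"
  proof -
    have "open (- (h ` {1..m} - {x}))" by (intro open_Compl finite_imp_closed) auto
    then have "\<forall>\<^sub>F y in nhds x. y \<in> - (h ` {1..m} - {x})" by (rule eventually_nhds_in_open) simp
    then show ?thesis by (auto simp: eventually_at_filter elim: eventually_mono)
  qed
  then show ?thesis by (metis at_le eventually_mono filter_leD subset_UNIV)
qed

lemma eventually_recip: "\<forall>\<^sub>F y in at x within S. inverse (G y) = recip y"
  using eventually_notin_h by (rule eventually_mono) (auto simp: recip_def)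

lemma recip_isCont:
  assumes "x \<notin> zero ` {1..Suc m}"
  shows "isCont recip x"
proof -
  have "((\<lambda>y. inverse (G y)) \<longlongrightarrow> recip x) (at x)"
  proof (cases "x \<in> h ` {1..m}")
    case True
    then obtain j where j: "j \<in> {1..m}" "x = h j" by blast
    have "((\<lambda>y. inverse (G y)) \<longlongrightarrow> 0) (at_left x)" "((\<lambda>y. inverse (G y)) \<longlongrightarrow> 0) (at_right x)"
      using tendsto_inverse_0_at_top[OF G_at_right[OF j(1)]]
        filterlim_compose[OF tendsto_inverse_0 filterlim_mono[OF G_at_left[OF j(1)] at_bot_le_at_infinity order_refl]]
      by (simp_all add: j)
    then show ?thesis using True by (simp add: filterlim_split_at recip_def)
  next
    case False
    then have "G x \<noteq> 0" using assms zero_iff by blast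
    then show ?thesis using G_isCont[OF False] False
      by (auto simp: recip_def isCont_def intro!: tendsto_intros)
  qed
  then show ?thesis unfolding isCont_def
    by (rule Lim_transform_eventually) (rule eventually_recip)
qed

lemma G_tendsto_zero: "i \<in> {1..Suc m} \<Longrightarrow> (G \<longlongrightarrow> 0) (at (zero i) within S)"
  using G_isCont[of "zero i"] zero_iff[of "zero i"]
  by (auto simp: isCont_def intro: tendsto_within_subset)

lemma eventually_pole_gap: "x \<in> pole_gap k \<Longrightarrow> \<forall>\<^sub>F y in at x within S. y \<in> pole_gap k"
  using eventually_at_topological open_cell by blast

lemma recip_at_left:
  assumes i: "i \<in> {1..Suc m}" shows "filterlim recip at_top (at_left (zero i))"
proof -
  have "\<forall>\<^sub>F x in at_left (zero i). x < zero i" by (simp add: eventually_at_filter)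
  then have "\<forall>\<^sub>F x in at_left (zero i). 0 < G x"
    using eventually_pole_gap[OF zero_in[OF i]]
    by eventually_elim (use G_less[of "i - 1" _ "zero i"] zero_in[OF i] G_zero[OF i] i in fastforce)
  from filterlim_inverse_at_top[OF G_tendsto_zero[OF i] this] show ?thesis
    by (rule filterlim_mono_eventually[OF _ order_refl order_refl])
      (rule eventually_recip)
qed

lemma recip_at_right:
  assumes i: "i \<in> {1..Suc m}" shows "filterlim recip at_bot (at_right (zero i))"
proof -
  have "\<forall>\<^sub>F x in at_right (zero i). zero i < x" by (simp add: eventually_at_filter)
  then have "\<forall>\<^sub>F x in at_right (zero i). G x < 0"
    using eventually_pole_gap[OF zero_in[OF i]]
    by eventually_elim (use G_less[of "i - 1" "zero i"] zero_in[OF i] G_zero[OF i] i in fastforce)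
  from filterlim_inverse_at_bot[OF G_tendsto_zero[OF i] this] show ?thesis
    by (rule filterlim_mono_eventually[OF _ order_refl order_refl])
      (rule eventually_recip)
qed

lemma recip_deriv:
  assumes "x \<notin> h ` {1..m}" "G x \<noteq> 0"
  shows "(recip has_real_derivative W x / (G x)\<^sup>2) (at x)"
proof -
  have "((\<lambda>y. inverse (G y)) has_real_derivative - (inverse (G x) * - W x * inverse (G x))) (at x)"
    by (rule DERIV_inverse'[OF G_deriv[OF assms(1)] assms(2)])
  then have d: "((\<lambda>y. inverse (G y)) has_real_derivative W x / (G x)\<^sup>2) (at x)"
    by (simp add: power2_eq_square field_simps)
  have "\<forall>\<^sub>F y in nhds x. recip y = inverse (G y)"
    using eventually_recip[of x UNIV] assms by (auto simp: eventually_at_filter recip_def elim!: eventually_mono)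
  from iffD2[OF DERIV_cong_ev[OF refl this refl] d] show ?thesis .
qed

end

section \<open>Complex inner products\<close>

lemma cinner_add_right: "cinner x (y + w) = cinner x y + cinner x (w :: 'a::complex_hilbert)"
  by (metis cinner_commute cinner_add_left complex_cnj_add)

lemma cinner_scaleC_right: "cinner x (a *\<^sub>C y) = cnj a * cinner x (y :: 'a::complex_hilbert)"
  by (metis cinner_commute cinner_scaleC_left complex_cnj_mult)

lemma cinner_zero_left [simp]: "cinner 0 (y :: 'a::complex_hilbert) = 0"
  using cinner_add_left[of 0 0 y] by simp

lemma cinner_zero_right [simp]: "cinner (y :: 'a::complex_hilbert) 0 = 0"
  using cinner_add_right[of y 0 0] by simp

lemma cinner_diff_left: "cinner (x - y) w = cinner x w - cinner y (w :: 'a::complex_hilbert)"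
  using cinner_add_left[of "x - y" y w] by simp

lemma cinner_diff_right: "cinner w (x - y) = cinner w x - cinner w (y :: 'a::complex_hilbert)"
  using cinner_add_right[of w "x - y" y] by simp

lemma cinner_sum_left: "cinner (\<Sum>k\<in>I. f k) (w :: 'a::complex_hilbert) = (\<Sum>k\<in>I. cinner (f k) w)"
  by (induction I rule: infinite_finite_induct) (auto simp: cinner_add_left)

lemma cinner_sum_right: "cinner (w :: 'a::complex_hilbert) (\<Sum>k\<in>I. f k) = (\<Sum>k\<in>I. cinner w (f k))"
  by (induction I rule: infinite_finite_induct) (auto simp: cinner_add_right)

lemmas cinner_simps = cinner_add_left cinner_add_right cinner_diff_left cinner_diff_right
  cinner_scaleC_left cinner_scaleC_right cinner_sum_left cinner_sum_right

lemma cinner_self_eq_0 [simp]: "cinner x x = 0 \<longleftrightarrow> x = (0 :: 'a::complex_hilbert)"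
  by (simp add: cinner_self)

lemma cinner_eq_0_commute: "cinner x y = 0 \<longleftrightarrow> cinner y (x :: 'a::complex_hilbert) = 0"
  by (metis cinner_commute complex_cnj_zero)

lemma scaleC_eq_0 [simp]: "a *\<^sub>C x = 0 \<longleftrightarrow> a = 0 \<or> x = (0 :: 'a::complex_hilbert)"
  by (rule complex_vs.scale_eq_0_iff)

lemma scaleC_one [simp]: "1 *\<^sub>C x = (x :: 'a::complex_hilbert)"
  by (rule complex_vs.scale_one)

lemma PZ_eq:
  assumes z: "norm (z :: 'a::complex_hilbert) = 1"
  shows "PZ z u = cinner u z *\<^sub>C z"
proof -
  have zz: "cinner z z = 1" using z by (simp add: cinner_self)
  have span: "cspan {z} = range (\<lambda>a. a *\<^sub>C z)" by (rule complex_vs.span_singleton)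
  show ?thesis unfolding PZ_def orth_proj_def
  proof (rule the_equality)
    show "cinner u z *\<^sub>C z \<in> cspan {z} \<and> (\<forall>s\<in>cspan {z}. cinner (u - cinner u z *\<^sub>C z) s = 0)"
      by (auto simp: span cinner_simps zz)
  next
    fix p assume p: "p \<in> cspan {z} \<and> (\<forall>s\<in>cspan {z}. cinner (u - p) s = 0)"
    then obtain a where a: "p = a *\<^sub>C z" by (auto simp: span)
    have "z \<in> cspan {z}" by (rule complex_vs.span_base) simp
    then have "cinner (u - p) z = 0" using p by blast
    then show "p = cinner u z *\<^sub>C z" by (simp add: a cinner_simps zz)
  qed
qed

lemma Zperp_eq: "Zperp (z :: 'a::complex_hilbert) = {u. cinner u z = 0}"
proof -
  have span: "cspan {z} = range (\<lambda>a. a *\<^sub>C z)" by (rule complex_vs.span_singleton)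
  have "(\<forall>a. cinner u (a *\<^sub>C z) = 0) \<longleftrightarrow> cinner u z = 0" for u
    by (simp add: cinner_simps) (metis complex_cnj_one_iff zero_neq_one)
  then show ?thesis by (simp add: Zperp_def orth_compl_def span)
qed

lemma cdim_zero [simp]: "cdim {0 :: 'a::complex_hilbert} = 0"
  using complex_vs.dim_unique[of "{}" "{0}" 0] by (simp add: complex_vs.independent_empty)

lemma cdim_line:
  assumes "(u :: 'a::complex_hilbert) \<in> V" "u \<noteq> 0" "V \<subseteq> range (\<lambda>a. a *\<^sub>C u)"
  shows "cdim V = 1"
  by (rule complex_vs.dim_unique[of "{u}"])
    (use assms in \<open>auto simp: complex_vs.span_singleton complex_vs.dependent_single\<close>)

text \<open>Used to see that \<open>n\<close> orthogonal vectors are complete: one more vector orthogonal to all of them would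
exceed the dimension.\<close>

lemma card_orthogonal_le_cdim:
  assumes findim: "\<exists>T. finite T \<and> cspan T = (UNIV :: 'a::complex_hilbert set)"
    and S: "finite S" "(0 :: 'a) \<notin> S" "\<And>x y. x \<in> S \<Longrightarrow> y \<in> S \<Longrightarrow> x \<noteq> y \<Longrightarrow> cinner x y = 0"
  shows "card S \<le> cdim (UNIV :: 'a set)"
proof -
  have ind: "complex_vs.independent S"
  proof (rule complex_vs.independent_if_scalars_zero[OF S(1)])
    fix f x assume f: "(\<Sum>x\<in>S. f x *\<^sub>C x) = 0" and x: "x \<in> S"
    have "0 = cinner (\<Sum>y\<in>S. f y *\<^sub>C y) x" by (simp add: f)
    also have "\<dots> = (\<Sum>y\<in>S. f y * cinner y x)" by (simp add: cinner_simps)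
    also have "\<dots> = (\<Sum>y\<in>S. if y = x then f x * cinner x x else 0)"
      by (rule sum.cong) (use S(3) x in auto)
    also have "\<dots> = f x * cinner x x" using S(1) x by simp
    finally show "f x = 0" using x S(2) by auto
  qed
  obtain T :: "'a set" where T: "finite T" "cspan T = UNIV" using findim by blast
  obtain b :: "'a set" where b: "b \<subseteq> UNIV" "complex_vs.independent b" "UNIV \<subseteq> cspan b"
      "card b = cdim (UNIV :: 'a set)"
    by (rule complex_vs.basis_exists[of UNIV])
  have "finite b" using complex_vs.independent_span_bound[OF T(1) b(2)] T(2) by simp
  then show ?thesis using complex_vs.independent_span_bound[OF _ ind, of b] b(3,4) by auto
qed

section \<open>Operators in bordered diagonal form\<close>

text \<open>In the basis \<open>z, \<psi> 1, \<dots>, \<psi> m\<close> the matrix of \<open>X\<close> is diagonal except for the row and the column of \<open>z\<close>.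
The assumption \<open>cyclic\<close> is \<open>\<Gamma> = \<emptyset>\<close>: no eigenvector is orthogonal to \<open>z\<close>.\<close>

locale bordered = 
  fixes X :: "'a::complex_hilbert \<Rightarrow> 'a" and z :: 'a and m :: nat and h :: "nat \<Rightarrow> real"
    and \<psi> :: "nat \<Rightarrow> 'a" and \<sigma> :: "nat \<Rightarrow> complex" and c :: real
  assumes X: "selfadjoint X" and z: "norm z = 1" and h: "strict_mono_on {1..m} h"
    and cyclic: "\<And>u l. X u = l *\<^sub>C u \<Longrightarrow> cinner u z = 0 \<Longrightarrow> u = 0"
    and X\<psi>: "\<And>k. k \<in> {1..m} \<Longrightarrow> X (\<psi> k) = complex_of_real (h k) *\<^sub>C \<psi> k + \<sigma> k *\<^sub>C z"
    and \<psi>z: "\<And>k. k \<in> {1..m} \<Longrightarrow> cinner (\<psi> k) z = 0"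
    and \<psi>\<psi>: "\<And>j k. j \<in> {1..m} \<Longrightarrow> k \<in> {1..m} \<Longrightarrow> cinner (\<psi> j) (\<psi> k) = (if j = k then 1 else 0)"
    and complete: "\<And>u. cinner u z = 0 \<Longrightarrow> (\<And>k. k \<in> {1..m} \<Longrightarrow> cinner u (\<psi> k) = 0) \<Longrightarrow> u = 0"
    and c: "cinner (X z) z = complex_of_real c"
begin

lemma zz: "cinner z z = 1" using z by (simp add: cinner_self)

lemma z\<psi>: "k \<in> {1..m} \<Longrightarrow> cinner z (\<psi> k) = 0"
  using \<psi>z cinner_eq_0_commute by blast

lemma sym: "cinner (X u) w = cinner u (X w)"
  using X by (simp add: selfadjoint_def)

lemma X_add: "X (u + w) = X u + X w" and X_scale: "X (a *\<^sub>C u) = a *\<^sub>C X u"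
  using X module_hom.add[of scaleC scaleC X] module_hom.scale[of scaleC scaleC X]
  by (auto simp: selfadjoint_def linear_iff_module_hom)

lemma X_diff: "X (u - w) = X u - X w"
  using X_add[of "u - w" w] by simp

text \<open>Otherwise \<open>\<psi> k\<close> would be an eigenvector of \<open>X\<close> orthogonal to \<open>z\<close>.\<close>

lemma \<sigma>_nonzero: "k \<in> {1..m} \<Longrightarrow> \<sigma> k \<noteq> 0"
  using cyclic[of "\<psi> k" "complex_of_real (h k)"] X\<psi>[of k] \<psi>z[of k] \<psi>\<psi>[of k k] by auto

sublocale pick_function m h "\<lambda>k. (cmod (\<sigma> k))\<^sup>2" c
  by unfold_locales (use h \<sigma>_nonzero in auto)

lemma eq_if_coordinates_eq:
  assumes "cinner u z = cinner w z" "\<And>k. k \<in> {1..m} \<Longrightarrow> cinner u (\<psi> k) = cinner w (\<psi> k)"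
  shows "u = w"
  using complete[of "u - w"] assms by (simp add: cinner_simps)

definition vec :: "complex \<Rightarrow> (nat \<Rightarrow> complex) \<Rightarrow> 'a"
  where "vec x d = x *\<^sub>C z + (\<Sum>k=1..m. d k *\<^sub>C \<psi> k)"

lemma vec_z [simp]: "cinner (vec x d) z = x"
  using \<psi>z by (simp add: vec_def cinner_simps zz)

lemma vec_\<psi> [simp]:
  assumes "k \<in> {1..m}" shows "cinner (vec x d) (\<psi> k) = d k"
proof -
  have "(\<Sum>j=1..m. d j * cinner (\<psi> j) (\<psi> k)) = (\<Sum>j=1..m. if j = k then d k else 0)"
    by (rule sum.cong) (use \<psi>\<psi> assms in auto)
  then show ?thesis using assms z\<psi> by (simp add: vec_def cinner_simps)
qed

lemma vec_self: "vec (cinner u z) (\<lambda>k. cinner u (\<psi> k)) = u"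
  by (rule eq_if_coordinates_eq) simp_all

lemma cinner_X_\<psi>:
  assumes "k \<in> {1..m}"
  shows "cinner (X u) (\<psi> k) = h k * cinner u (\<psi> k) + cnj (\<sigma> k) * cinner u z"
  by (simp add: sym X\<psi>[OF assms] cinner_simps)

lemma Xz: "X z = vec c (\<lambda>k. cnj (\<sigma> k))"
  by (rule eq_if_coordinates_eq) (use c cinner_X_\<psi>[of _ z] z\<psi> zz in auto)

lemma cinner_X_z: "cinner (X u) z = c * cinner u z + (\<Sum>k=1..m. \<sigma> k * cinner u (\<psi> k))"
  by (simp add: sym Xz vec_def cinner_simps)

lemma shift_eq_iff:
  "X u - l *\<^sub>C u = y \<longleftrightarrow>
    (c - l) * cinner u z + (\<Sum>k=1..m. \<sigma> k * cinner u (\<psi> k)) = cinner y z \<and>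
    (\<forall>k\<in>{1..m}. (h k - l) * cinner u (\<psi> k) + cnj (\<sigma> k) * cinner u z = cinner y (\<psi> k))"
  (is "_ \<longleftrightarrow> ?R")
proof
  assume y: "X u - l *\<^sub>C u = y"
  show ?R unfolding y[symmetric] by (auto simp: cinner_simps cinner_X_z cinner_X_\<psi> algebra_simps)
next
  assume ?R
  then show "X u - l *\<^sub>C u = y"
    by (intro eq_if_coordinates_eq) (auto simp: cinner_simps cinner_X_z cinner_X_\<psi> algebra_simps)
qed

text \<open>\<open>G\<close> is the Schur complement that remains after the components along the \<open>\<psi> k\<close> have been eliminated
from \<open>X - l\<close>.\<close>

lemma of_real_G: "complex_of_real (G l) = c - l - (\<Sum>k=1..m. \<sigma> k * cnj (\<sigma> k) / (h k - complex_of_real l))"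
  by (simp add: G_def complex_norm_square del: of_real_power)

text \<open>Elimination of the \<open>\<psi>\<close>-components for an arbitrary right-hand side; \<open>x\<close> is the \<open>z\<close>-component of the
solution.\<close>

lemma solve_shift:
  assumes l: "l \<notin> h ` {1..m}" "G l \<noteq> 0"
  obtains u where "X u - complex_of_real l *\<^sub>C u = y"
proof -
  define x where "x = (cinner y z - (\<Sum>k=1..m. \<sigma> k * cinner y (\<psi> k) / (h k - complex_of_real l))) / G l"
  define d where "d k = (cinner y (\<psi> k) - cnj (\<sigma> k) * x) / (h k - complex_of_real l)" for k
  have nz: "h k - complex_of_real l \<noteq> 0" if "k \<in> {1..m}" for k
    using l that by auto
  have "(\<Sum>k=1..m. \<sigma> k * d k) = (\<Sum>k=1..m. \<sigma> k * cinner y (\<psi> k) / (h k - complex_of_real l))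
      - x * (\<Sum>k=1..m. \<sigma> k * cnj (\<sigma> k) / (h k - complex_of_real l))"
    by (simp add: d_def sum_subtractf[symmetric] sum_distrib_left diff_divide_distrib algebra_simps)
  then have "(c - l) * x + (\<Sum>k=1..m. \<sigma> k * d k) =
      x * G l + (\<Sum>k=1..m. \<sigma> k * cinner y (\<psi> k) / (h k - complex_of_real l))"
    by (simp add: of_real_G algebra_simps)
  also have "\<dots> = cinner y z" using l by (simp add: x_def)
  finally have "X (vec x d) - complex_of_real l *\<^sub>C vec x d = y"
    unfolding shift_eq_iff using nz by (auto simp: d_def)
  then show thesis by (rule that)
qed

lemma solution_off_h:
  assumes l: "l \<notin> h ` {1..m}"
    and u: "X u - complex_of_real l *\<^sub>C u = \<tau> *\<^sub>C z"
  shows "\<And>k. k \<in> {1..m} \<Longrightarrow> cinner u (\<psi> k) = - (cnj (\<sigma> k) * cinner u z / (h k - complex_of_real l))"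
    and "cinner u z * G l = \<tau>"
proof -
  have nz: "h k - complex_of_real l \<noteq> 0" if "k \<in> {1..m}" for k
    using l that by auto
  have 1: "(c - l) * cinner u z + (\<Sum>k=1..m. \<sigma> k * cinner u (\<psi> k)) = \<tau>"
    and 2: "\<forall>k\<in>{1..m}. (h k - complex_of_real l) * cinner u (\<psi> k) + cnj (\<sigma> k) * cinner u z = 0"
    using u z\<psi> unfolding shift_eq_iff by (auto simp: cinner_simps zz)
  show 3: "cinner u (\<psi> k) = - (cnj (\<sigma> k) * cinner u z / (h k - complex_of_real l))" if "k \<in> {1..m}" for k
    using 2 nz[OF that] that by (simp add: field_simps eq_neg_iff_add_eq_0)
  have "(\<Sum>k=1..m. \<sigma> k * cinner u (\<psi> k)) =
      - cinner u z * (\<Sum>k=1..m. \<sigma> k * cnj (\<sigma> k) / (h k - complex_of_real l))"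
    unfolding sum_distrib_left by (rule sum.cong) (auto simp: 3)
  then show "cinner u z * G l = \<tau>" using 1 by (simp add: of_real_G algebra_simps)
qed

text \<open>Off the poles the \<open>\<psi>\<close>-components of \<open>u\<close> are determined by \<open>x\<close>, and the \<open>z\<close>-component of the equation
becomes \<open>x * G l = \<tau>\<close>. At a pole \<open>h j\<close> the \<open>j\<close>-th component of the equation reads
\<open>cnj (\<sigma> j) * x = 0\<close>, and then a suitable multiple of \<open>\<psi> j\<close> solves it for every \<open>\<tau>\<close>.\<close>

lemma response:
  "(\<exists>u. X u - complex_of_real l *\<^sub>C u = \<tau> *\<^sub>C z \<and> cinner u z = x) \<longleftrightarrow>
    (if l \<in> h ` {1..m} then x = 0 else x * G l = \<tau>)"
proof (cases "l \<in> h ` {1..m}")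
  case True
  then obtain j where j: "j \<in> {1..m}" "l = h j" by blast
  have "cinner u z = 0" if "X u - complex_of_real l *\<^sub>C u = \<tau> *\<^sub>C z" for u
    using that j \<sigma>_nonzero[OF j(1)] z\<psi>[OF j(1)] unfolding shift_eq_iff by (force simp: cinner_simps)
  moreover have "X (vec 0 (\<lambda>k. if k = j then \<tau> / \<sigma> j else 0)) -
      complex_of_real l *\<^sub>C vec 0 (\<lambda>k. if k = j then \<tau> / \<sigma> j else 0) = \<tau> *\<^sub>C z"
    unfolding shift_eq_iff using \<sigma>_nonzero[OF j(1)] z\<psi> j by (auto simp: cinner_simps zz mult_delta_right)
  ultimately show ?thesis using True vec_z by metis
next
  case False
  have "\<exists>u. X u - complex_of_real l *\<^sub>C u = \<tau> *\<^sub>C z \<and> cinner u z = x" if x: "x * G l = \<tau>"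
  proof -
    define u where "u = vec x (\<lambda>k. - (cnj (\<sigma> k) * x / (h k - complex_of_real l)))"
    have nz: "h k - complex_of_real l \<noteq> 0" if "k \<in> {1..m}" for k
      using False that by auto
    have "(\<Sum>k=1..m. \<sigma> k * cinner u (\<psi> k)) =
        - x * (\<Sum>k=1..m. \<sigma> k * cnj (\<sigma> k) / (h k - complex_of_real l))"
      unfolding sum_distrib_left by (rule sum.cong) (auto simp: u_def)
    then have "(c - l) * cinner u z + (\<Sum>k=1..m. \<sigma> k * cinner u (\<psi> k)) = \<tau>"
      by (simp add: x[symmetric] of_real_G u_def algebra_simps)
    then have "X u - complex_of_real l *\<^sub>C u = \<tau> *\<^sub>C z"
      unfolding shift_eq_iff using nz z\<psi> by (auto simp: cinner_simps zz u_def)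
    then show ?thesis by (auto simp: u_def)
  qed
  then show ?thesis using False solution_off_h[OF False] by auto
qed

lemma response_unique:
  assumes "X u - l *\<^sub>C u = \<tau> *\<^sub>C z" "X w - l *\<^sub>C w = \<tau> *\<^sub>C z" "cinner u z = cinner w z"
  shows "u = w"
  using cyclic[of "u - w" l] assms
  by (auto simp: cinner_simps X_diff complex_vs.scale_right_diff_distrib algebra_simps)

text \<open>An eigenvector is a solution with \<open>\<tau> = 0\<close>, and \<open>cyclic\<close> excludes \<open>x = 0\<close>.\<close>

lemma Spec_iff: "complex_of_real l \<in> Spec X \<longleftrightarrow> l \<notin> h ` {1..m} \<and> G l = 0"
proof -
  have "complex_of_real l \<in> Spec X \<longleftrightarrow> (\<exists>u. u \<noteq> 0 \<and> X u - complex_of_real l *\<^sub>C u = 0 *\<^sub>C z)"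
    by (simp add: Spec_def eigenspace_def)
  also have "\<dots> \<longleftrightarrow> (\<exists>x. x \<noteq> 0 \<and> (\<exists>u. X u - complex_of_real l *\<^sub>C u = 0 *\<^sub>C z \<and> cinner u z = x))"
    using cyclic[of _ "complex_of_real l"] by (metis cinner_zero_left complex_vs.scale_zero_left right_minus_eq)
  also have "\<dots> \<longleftrightarrow> l \<notin> h ` {1..m} \<and> G l = 0"
    unfolding response by (auto intro: exI[of _ 1])
  finally show ?thesis .
qed

lemma resolvent_eq:
  assumes "complex_of_real l \<notin> Spec X" "X u - complex_of_real l *\<^sub>C u = y"
  shows "resolvent X (complex_of_real l) y = u"
proof -
  have "inj (\<lambda>u. X u - complex_of_real l *\<^sub>C u)"
  proof (rule injI)
    fix u w assume "X u - complex_of_real l *\<^sub>C u = X w - complex_of_real l *\<^sub>C w"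
    then have "X (u - w) = complex_of_real l *\<^sub>C (u - w)"
      by (simp add: X_diff complex_vs.scale_right_diff_distrib algebra_simps)
    then have "u - w = 0" using assms(1) unfolding Spec_def eigenspace_def by blast
    then show "u = w" by simp
  qed
  then show ?thesis unfolding resolvent_def assms(2)[symmetric] by (rule inv_f_f)
qed

lemma cinner_resolvent:
  assumes l: "complex_of_real l \<notin> Spec X"
  shows "cinner (resolvent X l (a *\<^sub>C z)) z = a * recip l"
proof -
  have "if l \<in> h ` {1..m} then complex_of_real (recip l) = 0 else recip l * G l = 1"
    using l by (auto simp: Spec_iff recip_def)
  then have "if l \<in> h ` {1..m} then a * recip l = 0 else (a * recip l) * G l = a"
    by (auto simp flip: of_real_mult)
  then obtain u where "X u - complex_of_real l *\<^sub>C u = a *\<^sub>C z" "cinner u z = a * recip l"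
    unfolding response[symmetric] by blast
  then show ?thesis using resolvent_eq[OF l, of u] by simp
qed

text \<open>With \<open>u = (X - l)\<^sup>-\<^sup>1 z\<close> and \<open>l\<close> real the left-hand side is \<open>\<langle>u, u\<rangle>\<close>, because \<open>X - l\<close> is symmetric; the
coordinates of \<open>u\<close> are explicit, and the sum of their squared moduli is \<open>W l / (G l)\<^sup>2\<close>.\<close>

lemma cinner_resolvent2:
  assumes l: "complex_of_real l \<notin> Spec X" "l \<notin> h ` {1..m}"
  shows "cinner (resolvent X l (resolvent X l z)) z = complex_of_real (W l / (G l)\<^sup>2)"
proof -
  have G: "G l \<noteq> 0" using l by (auto simp: Spec_iff)
  obtain u where u: "X u - complex_of_real l *\<^sub>C u = z" using solve_shift[OF l(2) G] by blast
  obtain w where w: "X w - complex_of_real l *\<^sub>C w = u" using solve_shift[OF l(2) G] by blast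
  have u': "X u - complex_of_real l *\<^sub>C u = 1 *\<^sub>C z" using u by simp
  have uz: "cinner u z = complex_of_real (inverse (G l))"
    using solution_off_h(2)[OF l(2) u'] G by (simp add: field_simps)
  have k: "cinner u (\<psi> k) * cnj (cinner u (\<psi> k)) = complex_of_real ((cmod (\<sigma> k))\<^sup>2 / (h k - l)\<^sup>2 / (G l)\<^sup>2)"
    if "k \<in> {1..m}" for k
    unfolding solution_off_h(1)[OF l(2) u' that] uz complex_norm_square of_real_divide
    by (simp add: field_simps power2_eq_square)
  have "cinner w z = cinner u u"
  proof -
    have "cinner w z = cinner (X w - complex_of_real l *\<^sub>C w) u"
      unfolding u[symmetric] by (simp add: cinner_simps sym)
    then show ?thesis by (simp add: w)
  qed
  also have "\<dots> = cinner u (vec (cinner u z) (\<lambda>k. cinner u (\<psi> k)))" by (simp add: vec_self)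
  also have "\<dots> = cinner u z * cnj (cinner u z) + (\<Sum>k=1..m. cinner u (\<psi> k) * cnj (cinner u (\<psi> k)))"
    by (simp add: vec_def cinner_simps mult.commute)
  also have "\<dots> = complex_of_real (1 / (G l)\<^sup>2 + (\<Sum>k=1..m. (cmod (\<sigma> k))\<^sup>2 / (h k - l)\<^sup>2 / (G l)\<^sup>2))"
    by (simp add: k) (simp add: uz power2_eq_square field_simps)
  also have "1 / (G l)\<^sup>2 + (\<Sum>k=1..m. (cmod (\<sigma> k))\<^sup>2 / (h k - l)\<^sup>2 / (G l)\<^sup>2) = W l / (G l)\<^sup>2"
    by (simp add: W_def add_divide_distrib sum_divide_distrib)
  finally show ?thesis using resolvent_eq[OF l(1) u] resolvent_eq[OF l(1) w] by simp
qed

text \<open>The set is the eigenspace of the rank-one perturbation \<open>X - t P\<close>. By \<open>response\<close> with \<open>\<tau> = t * x\<close> it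
contains a vector with \<open>x \<noteq> 0\<close> exactly if \<open>G l = t\<close>, for real \<open>l\<close>; the perturbation being self-adjoint, no other \<open>l\<close> is an eigenvalue.
By \<open>response_unique\<close> the dimension is at most one.\<close>

lemma cdim_rank_one:
  "cdim {u. X u - (complex_of_real t * cinner u z) *\<^sub>C z = l *\<^sub>C u} =
    (if l \<in> complex_of_real ` {r. r \<notin> h ` {1..m} \<and> G r = t} then 1 else 0)"
proof -
  let ?E = "{u. X u - (complex_of_real t * cinner u z) *\<^sub>C z = l *\<^sub>C u}"
  have E: "u \<in> ?E \<longleftrightarrow> X u - l *\<^sub>C u = (complex_of_real t * cinner u z) *\<^sub>C z" for u
    by (auto simp: algebra_simps)
  have nz: "cinner u z \<noteq> 0" if "u \<in> ?E" "u \<noteq> 0" for u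
    using that cyclic[of u l] by auto
  show ?thesis
  proof (cases "\<exists>u\<in>?E. u \<noteq> 0")
    case True
    then obtain u where u: "u \<in> ?E" "u \<noteq> 0" by blast
    have "w = (cinner w z / cinner u z) *\<^sub>C u" if "w \<in> ?E" for w
    proof (rule response_unique)
      show "X w - l *\<^sub>C w = (complex_of_real t * cinner w z) *\<^sub>C z" using that E by blast
      let ?a = "cinner w z / cinner u z"
      have "X (?a *\<^sub>C u) - l *\<^sub>C ?a *\<^sub>C u = ?a *\<^sub>C (X u - l *\<^sub>C u)"
        by (simp add: X_scale complex_vs.scale_right_diff_distrib mult.commute)
      also have "\<dots> = (complex_of_real t * cinner w z) *\<^sub>C z"
        using u E[of u] nz[OF u] by simp
      finally show "X (?a *\<^sub>C u) - l *\<^sub>C ?a *\<^sub>C u = (complex_of_real t * cinner w z) *\<^sub>C z" .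
      show "cinner w z = cinner (?a *\<^sub>C u) z" using nz[OF u] by (simp add: cinner_simps)
    qed
    then have "?E \<subseteq> range (\<lambda>a. a *\<^sub>C u)" by blast
    then have dim: "cdim ?E = 1" using cdim_line[of u ?E] u by blast
    have "cinner (X u) u = (l * cinner u u) + complex_of_real t * (cinner u z * cnj (cinner u z))"
      using u E[of u] by (simp add: algebra_simps cinner_simps cinner_commute[of z u])
    moreover have "cnj (cinner (X u) u) = cinner (X u) u"
      using cinner_commute[of u "X u"] by (simp add: sym)
    moreover have "cnj (cinner u u) = cinner u u" by (rule cinner_commute[symmetric])
    ultimately have "cnj l * cinner u u = l * cinner u u"
      by (simp add: mult.commute)
    then have "cnj l = l" using u by simp
    then obtain r where r: "l = complex_of_real r" by (metis Reals_cases Reals_cnj_iff)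
    have "if r \<in> h ` {1..m} then cinner u z = 0 else cinner u z * G r = t * cinner u z"
      using response[of r "t * cinner u z" "cinner u z"] u E[of u] r by blast
    then have "r \<notin> h ` {1..m} \<and> complex_of_real (G r) = complex_of_real t"
      using nz[OF u] by (auto split: if_splits)
    then show ?thesis using dim r by auto
  next
    case False
    then have 0: "?E = {0}" using E[of 0] X_scale[of 0 0] by auto
    have "l \<notin> complex_of_real ` {r. r \<notin> h ` {1..m} \<and> G r = t}"
    proof
      assume "l \<in> complex_of_real ` {r. r \<notin> h ` {1..m} \<and> G r = t}"
      then obtain r where r: "r \<notin> h ` {1..m}" "G r = t" "l = complex_of_real r" by blast
      then obtain u where "X u - l *\<^sub>C u = complex_of_real t *\<^sub>C z" "cinner u z = 1"
        using response[of r t 1] by auto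
      then have "u \<in> ?E" "u \<noteq> 0" using E[of u] by auto
      then show False using False by blast
    qed
    then show ?thesis using 0 by simp
  qed
qed

end

section \<open>Simple spectra and the interlacing of eigenvalues\<close>

lemma card_fibres_iff_bij_betw:
  assumes I: "finite I"
  shows "(\<forall>l. card {i \<in> I. complex_of_real (e i) = l} = (if l \<in> complex_of_real ` E then 1 else 0)) \<longleftrightarrow>
    bij_betw e I E" (is "?L \<longleftrightarrow> ?R")
proof
  assume L: ?L
  have inE: "e i \<in> E" if "i \<in> I" for i
  proof (rule ccontr)
    assume "e i \<notin> E"
    then have "complex_of_real (e i) \<notin> complex_of_real ` E" by auto
    then have "card {j \<in> I. complex_of_real (e j) = complex_of_real (e i)} = 0"
      using L by presburger
    then show False using I that by auto
  qed
  have "inj_on e I"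
  proof (rule inj_onI)
    fix i j assume ij: "i \<in> I" "j \<in> I" "e i = e j"
    have "card {k \<in> I. complex_of_real (e k) = complex_of_real (e i)} = 1"
      using L inE[OF ij(1)] by (metis image_eqI)
    then obtain k where "{k \<in> I. complex_of_real (e k) = complex_of_real (e i)} = {k}"
      by (rule card_1_singletonE)
    then show "i = j" using ij by (metis (mono_tags, lifting) mem_Collect_eq singletonD)
  qed
  moreover have "r \<in> e ` I" if r: "r \<in> E" for r
  proof -
    have "card {k \<in> I. complex_of_real (e k) = complex_of_real r} = 1" using L r by (metis image_eqI)
    then obtain k where "{k \<in> I. complex_of_real (e k) = complex_of_real r} = {k}"
      by (rule card_1_singletonE)
    then show ?thesis by auto
  qed
  ultimately show ?R using inE by (auto simp: bij_betw_def)
next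
  assume R: ?R
  show ?L
  proof
    fix l
    show "card {i \<in> I. complex_of_real (e i) = l} = (if l \<in> complex_of_real ` E then 1 else 0)"
    proof (cases "l \<in> complex_of_real ` E")
      case True
      then obtain i where i: "i \<in> I" "l = complex_of_real (e i)" using R by (auto simp: bij_betw_def)
      then have "{j \<in> I. complex_of_real (e j) = l} = {i}"
        using R by (auto simp: bij_betw_def dest: inj_onD)
      then show ?thesis using True by simp
    next
      case False
      then have "{j \<in> I. complex_of_real (e j) = l} = {}" using R by (auto simp: bij_betw_def)
      then have "card {j \<in> I. complex_of_real (e j) = l} = 0" by (metis card.empty)
      then show ?thesis using False by simp
    qed
  qed
qed

lemma strict_mono_on_eqI:
  fixes e f :: "nat \<Rightarrow> real"
  assumes e: "mono_on {1..n} e" "inj_on e {1..n}" and f: "strict_mono_on {1..n} f"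
    and ef: "e ` {1..n} = f ` {1..n}" and j: "j \<in> {1..n}"
  shows "e j = f j"
proof -
  have s: "set [1..<Suc n] = {1..n}" by auto
  have "map e [1..<Suc n] = map f [1..<Suc n]"
  proof (rule sorted_distinct_set_unique)
    show "sorted (map e [1..<Suc n])"
      using e(1) by (auto simp: sorted_iff_nth_mono mono_on_def simp del: upt_Suc)
    show "sorted (map f [1..<Suc n])"
      using strict_mono_on_imp_mono_on[OF f] by (auto simp: sorted_iff_nth_mono mono_on_def simp del: upt_Suc)
    show "distinct (map e [1..<Suc n])" "distinct (map f [1..<Suc n])"
      using e(2) strict_mono_on_imp_inj_on[OF f] unfolding distinct_map s by simp_all
    show "set (map e [1..<Suc n]) = set (map f [1..<Suc n])" using ef by (simp only: set_map s)
  qed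
  then show ?thesis using j s by (metis map_eq_conv)
qed

context bordered begin

text \<open>Each of the eigenvalues of \<open>X - t P\<close> is simple and lies on exactly one branch, so listing them with
multiplicity is the same as matching the list with the branches.\<close>

lemma enumerates_rank_one_iff:
  assumes "finite I"
  shows "enumerates_eigenvalues UNIV (\<lambda>u. X u - (complex_of_real t * cinner u z) *\<^sub>C z) I e \<longleftrightarrow>
    bij_betw e I ((\<lambda>k. branch k t) ` {..m})"
proof -
  have "{r. r \<notin> h ` {1..m} \<and> G r = t} = (\<lambda>k. branch k t) ` {..m}"
    using G_eq_iff by auto
  then show ?thesis
    unfolding enumerates_eigenvalues_def eigenspace_def
    using card_fibres_iff_bij_betw[OF assms, of e "(\<lambda>k. branch k t) ` {..m}"]
    by (simp add: cdim_rank_one)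
qed

text \<open>The case \<open>t = 0\<close>. The interlacing of the eigenvalues of \<open>X\<close> with those of its compression is
contained in this identification, as the \<open>j\<close>-th zero lies between the poles \<open>h (j - 1)\<close> and \<open>h j\<close>.\<close>

lemma ordered_eigenvalues_eq_zero:
  assumes e: "ordered_eigenvalues UNIV X (Suc m) e" and j: "j \<in> {1..Suc m}"
  shows "e j = zero j"
proof -
  have "(\<lambda>u. X u - (complex_of_real 0 * cinner u z) *\<^sub>C z) = X" by simp
  then have "bij_betw e {1..Suc m} ((\<lambda>k. branch k 0) ` {..m})"
    using e enumerates_rank_one_iff[of "{1..Suc m}" 0 e] by (simp add: ordered_eigenvalues_def)
  then show ?thesis
    using e strict_mono_on_eqI[OF _ _ zero_strict_mono _ j, of e] unfolding zero_image
    by (simp add: ordered_eigenvalues_def bij_betw_def)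
qed

lemma Spec_iff_zero: "complex_of_real l \<in> Spec X \<longleftrightarrow> l \<in> zero ` {1..Suc m}"
  using Spec_iff zero_iff by simp

end

text \<open>The spectral theorem for the compression comes for free: its eigenvalues are listed with geometric
multiplicity and there are \<open>m\<close> of them, so there are \<open>m\<close> eigenvectors. They are orthogonal because the
eigenvalues are distinct, and these are distinct for the following reason. An eigenvector of the
compression in \<open>Z\<^sup>\<bottom>\<close> satisfies \<open>(X - l) u = s z\<close> with \<open>s \<noteq> 0\<close>, so a suitable combination of two of
them is annihilated by \<open>X - l\<close> and orthogonal to \<open>z\<close>, hence zero.\<close>

lemma bordered_exists:
  fixes X :: "'a::complex_hilbert \<Rightarrow> 'a"
  assumes findim: "\<exists>S. finite S \<and> cspan S = (UNIV :: 'a set)"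
    and dim: "cdim (UNIV :: 'a set) \<le> Suc m"
    and X: "selfadjoint X" and z: "norm z = 1"
    and eig: "ordered_eigenvalues (Zperp z) (compression z X) m h"
    and \<Gamma>: "Gam z X = {}"
  shows "\<exists>\<psi> \<sigma> c. bordered X z m h \<psi> \<sigma> c"
proof -
  define E where "E l = eigenspace (Zperp z) (compression z X) (complex_of_real l)" for l
  have E: "u \<in> E l \<longleftrightarrow> cinner u z = 0 \<and> X u = complex_of_real l *\<^sub>C u + cinner (X u) z *\<^sub>C z" for u l
    by (auto simp: E_def eigenspace_def Zperp_eq compression_def QZ_def PZ_eq[OF z] algebra_simps)
  have ED: "cinner u z = 0" "\<exists>s. X u = complex_of_real l *\<^sub>C u + s *\<^sub>C z" if "u \<in> E l" for u l
  proof -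
    from that have *: "cinner u z = 0" "X u = complex_of_real l *\<^sub>C u + cinner (X u) z *\<^sub>C z"
      unfolding E by (rule conjunct1, rule conjunct2)
    show "cinner u z = 0" by (rule *)
    show "\<exists>s. X u = complex_of_real l *\<^sub>C u + s *\<^sub>C z" by (rule exI, rule *(2))
  qed
  have cyclic: "u = 0" if "X u = l *\<^sub>C u" "cinner u z = 0" for u l
    using \<Gamma> that cinner_eq_0_commute[of u z] by (auto simp: Gam_def Spec_def eigenspace_def)
  have add: "X (u + w) = X u + X w" and scale: "X (a *\<^sub>C u) = a *\<^sub>C X u" for u w a
    using X module_hom.add[of scaleC scaleC X] module_hom.scale[of scaleC scaleC X]
    by (auto simp: selfadjoint_def linear_iff_module_hom)
  have diff: "X (u - w) = X u - X w" for u w using add[of "u - w" w] by simp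
  have sym: "cinner (X u) w = cinner u (X w)" for u w using X by (simp add: selfadjoint_def)
  have zz: "cinner z z = 1" using z by (simp add: cinner_self)
  have "card {i \<in> {1..m}. complex_of_real (h i) = complex_of_real l} = cdim (E l)" for l
    using eig unfolding ordered_eigenvalues_def enumerates_eigenvalues_def E_def by blast
  then have card: "card {i \<in> {1..m}. h i = l} = cdim (E l)" for l by simp
  have E0: "X 0 = 0" using scale[of 0 0] by simp
  have ray: "\<exists>a. w = a *\<^sub>C u" if uw: "u \<in> E l" "u \<noteq> 0" "w \<in> E l" for u w l
  proof -
    obtain s where s: "cinner u z = 0" "X u = complex_of_real l *\<^sub>C u + s *\<^sub>C z"
      using ED[OF uw(1)] by blast
    obtain s' where s': "cinner w z = 0" "X w = complex_of_real l *\<^sub>C w + s' *\<^sub>C z"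
      using ED[OF uw(3)] by blast
    have "s \<noteq> 0" using s uw(2) cyclic[of u "complex_of_real l"] by auto
    then have "X (w - (s' / s) *\<^sub>C u) = complex_of_real l *\<^sub>C (w - (s' / s) *\<^sub>C u)"
      by (simp add: diff scale s s' complex_vs.scale_right_diff_distrib complex_vs.scale_right_distrib mult.commute)
    moreover have "cinner (w - (s' / s) *\<^sub>C u) z = 0"
      using s s' by (simp add: cinner_simps)
    ultimately have "w - (s' / s) *\<^sub>C u = 0" by (rule cyclic)
    then show ?thesis by auto
  qed
  have ex: "\<exists>u. u \<in> E (h k) \<and> norm u = 1" if k: "k \<in> {1..m}" for k
  proof -
    have "card {i \<in> {1..m}. h i = h k} \<noteq> 0" using k by (subst card_eq_0_iff) auto
    then have "cdim (E (h k)) \<noteq> 0" unfolding card .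
    moreover have "0 \<in> E (h k)" unfolding E by (simp add: E0)
    ultimately have "\<exists>u\<in>E (h k). u \<noteq> 0" by (metis cdim_zero empty_iff subsetI subset_singletonD singletonI)
    then obtain u where u: "u \<in> E (h k)" "u \<noteq> 0" by blast
    obtain s where s: "X u = complex_of_real (h k) *\<^sub>C u + s *\<^sub>C z" "cinner u z = 0"
      using ED[OF u(1)] by blast
    have "inverse (norm u) *\<^sub>R u \<in> E (h k)"
      unfolding E scaleC_of_real[symmetric]
      by (simp add: cinner_simps scale s zz complex_vs.scale_right_distrib mult.commute)
    moreover have "norm (inverse (norm u) *\<^sub>R u) = 1" using u(2) by simp
    ultimately show ?thesis by blast
  qed
  then obtain \<psi> where \<psi>: "\<And>k. k \<in> {1..m} \<Longrightarrow> \<psi> k \<in> E (h k)" "\<And>k. k \<in> {1..m} \<Longrightarrow> norm (\<psi> k) = 1"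
    by metis
  have inj: "inj_on h {1..m}"
  proof (rule inj_onI)
    fix i j assume ij: "i \<in> {1..m}" "j \<in> {1..m}" "h i = h j"
    have "E (h i) \<subseteq> range (\<lambda>a. a *\<^sub>C \<psi> i)" "\<psi> i \<noteq> 0"
      using ray[OF \<psi>(1)[OF ij(1)]] \<psi>(2)[OF ij(1)] by fastforce+
    then have "cdim (E (h i)) = 1" using cdim_line \<psi>(1)[OF ij(1)] by blast
    then obtain k where "{k \<in> {1..m}. h k = h i} = {k}"
      using card[of "h i"] by (metis card_1_singletonE)
    then show "i = j" using ij by (metis (mono_tags, lifting) mem_Collect_eq singletonD)
  qed
  have mono: "strict_mono_on {1..m} h"
    using eig inj unfolding ordered_eigenvalues_def
    by (intro strict_mono_onI) (metis inj_onD less_imp_le mono_onD order_less_le)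
  have orth: "cinner (\<psi> j) (\<psi> k) = (if j = k then 1 else 0)" if jk: "j \<in> {1..m}" "k \<in> {1..m}" for j k
  proof (cases "j = k")
    case True
    then show ?thesis using \<psi>(2)[OF jk(1)] by (simp add: cinner_self)
  next
    case False
    have z0: "cinner (\<psi> j) z = 0" "cinner z (\<psi> k) = 0"
      using ED(1)[OF \<psi>(1)[OF jk(1)]] ED(1)[OF \<psi>(1)[OF jk(2)]] cinner_eq_0_commute by blast+
    have "cinner (X (\<psi> j)) (\<psi> k) = h j * cinner (\<psi> j) (\<psi> k)"
      using ED(2)[OF \<psi>(1)[OF jk(1)]] z0 by (auto simp: cinner_simps)
    moreover have "cinner (\<psi> j) (X (\<psi> k)) = h k * cinner (\<psi> j) (\<psi> k)"
      using ED(2)[OF \<psi>(1)[OF jk(2)]] z0 by (auto simp: cinner_simps)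
    moreover have "h j \<noteq> h k" using inj jk False by (auto dest: inj_onD)
    ultimately show ?thesis using False sym by auto
  qed
  have complete: "u = 0" if u: "cinner u z = 0" "\<And>k. k \<in> {1..m} \<Longrightarrow> cinner u (\<psi> k) = 0" for u
  proof (rule ccontr)
    assume "u \<noteq> 0"
    have \<psi>z: "cinner (\<psi> k) z = 0" "cinner z (\<psi> k) = 0" if "k \<in> {1..m}" for k
      using ED(1)[OF \<psi>(1)[OF that]] cinner_eq_0_commute by blast+
    have nz: "z \<noteq> 0" "0 \<notin> \<psi> ` {1..m}" using z \<psi>(2) by auto (metis atLeastAtMost_iff norm_zero zero_neq_one)
    have i\<psi>: "inj_on \<psi> {1..m}" using orth by (intro inj_onI) (metis zero_neq_one)
    have zS: "z \<notin> \<psi> ` {1..m}" using \<psi>z zz by (metis imageE zero_neq_one)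
    have "u \<notin> insert z (\<psi> ` {1..m})" using u \<open>u \<noteq> 0\<close> by (metis cinner_self_eq_0 imageE insertE)
    then have "card (insert u (insert z (\<psi> ` {1..m}))) = Suc (Suc m)"
      using zS card_image[OF i\<psi>] by simp
    moreover have "card (insert u (insert z (\<psi> ` {1..m}))) \<le> cdim (UNIV :: 'a set)"
    proof (rule card_orthogonal_le_cdim[OF findim])
      show "0 \<notin> insert u (insert z (\<psi> ` {1..m}))" using nz \<open>u \<noteq> 0\<close> by auto
      have u': "cinner z u = 0" "k \<in> {1..m} \<Longrightarrow> cinner (\<psi> k) u = 0" for k
        using u cinner_eq_0_commute by blast+
      fix x y assume "x \<in> insert u (insert z (\<psi> ` {1..m}))" "y \<in> insert u (insert z (\<psi> ` {1..m}))" "x \<noteq> y"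
      then show "cinner x y = 0" using u u' \<psi>z orth by (auto split: if_splits)
    qed simp
    ultimately show False using dim by simp
  qed
  have "cnj (cinner (X z) z) = cinner (X z) z"
    using cinner_commute[of z "X z"] by (simp add: sym)
  then obtain c where c: "cinner (X z) z = complex_of_real c" by (metis Reals_cases Reals_cnj_iff)
  have "bordered X z m h \<psi> (\<lambda>k. cinner (X (\<psi> k)) z) c"
  proof unfold_locales
    fix k assume "k \<in> {1..m}"
    then show "X (\<psi> k) = complex_of_real (h k) *\<^sub>C \<psi> k + cinner (X (\<psi> k)) z *\<^sub>C z" "cinner (\<psi> k) z = 0"
      using \<psi>(1) unfolding E by blast+
  qed (use X z mono cyclic orth complete c in blast)+
  then show ?thesis by blast
qed

section \<open>Pair-eigenvalues\<close>

locale coupled = A: bordered A z m hA \<psi>A \<sigma>A cA + B: bordered B z m hB \<psi>B \<sigma>B cB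
  for A B :: "'a::complex_hilbert \<Rightarrow> 'a" and z m hA hB \<psi>A \<psi>B \<sigma>A \<sigma>B cA cB +
  fixes \<kappa> :: real assumes \<kappa>: "\<kappa> \<noteq> 0"
begin

text \<open>With \<open>x = \<langle>u, z\<rangle>\<close> and \<open>y = \<langle>v, z\<rangle>\<close> the two equations say that \<open>A\<close> responds to \<open>-\<kappa> y\<close> with \<open>x\<close> and that \<open>B\<close>
responds to \<open>-\<kappa> x\<close> with \<open>y\<close>. This leaves a linear system in two unknowns, whose solvability is decided in
each of the four cases pole or no pole.\<close>

lemma pair_eigenvalue_iff:
  "pair_eigenvalue A B z \<kappa> (complex_of_real s, complex_of_real t) \<longleftrightarrow>
    (s \<in> hA ` {1..m} \<and> t \<notin> hB ` {1..m} \<and> B.G t = 0) \<or>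
    (s \<notin> hA ` {1..m} \<and> A.G s = 0 \<and> t \<in> hB ` {1..m}) \<or>
    (s \<notin> hA ` {1..m} \<and> t \<notin> hB ` {1..m} \<and> A.G s * B.G t = \<kappa>\<^sup>2)" (is "?L \<longleftrightarrow> ?R")
proof -
  have "?L \<longleftrightarrow> (\<exists>u v. (u, v) \<noteq> (0, 0) \<and>
     A u - complex_of_real s *\<^sub>C u = (- (\<kappa> * cinner v z)) *\<^sub>C z \<and>
     B v - complex_of_real t *\<^sub>C v = (- (\<kappa> * cinner u z)) *\<^sub>C z)"
    by (simp add: pair_eigenvalue_def PZ_eq[OF A.z] eq_neg_iff_add_eq_0 add.commute
        complex_vs.scale_minus_left)
  also have "\<dots> \<longleftrightarrow> (\<exists>(x::complex) (y::complex). (x, y) \<noteq> (0, 0) \<and>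
     (\<exists>u. A u - complex_of_real s *\<^sub>C u = (- (\<kappa> * y)) *\<^sub>C z \<and> cinner u z = x) \<and>
     (\<exists>v. B v - complex_of_real t *\<^sub>C v = (- (\<kappa> * x)) *\<^sub>C z \<and> cinner v z = y))" (is "?P \<longleftrightarrow> ?Q")
  proof
    assume ?P
    then obtain u v where uv: "(u, v) \<noteq> (0, 0)"
      "A u - complex_of_real s *\<^sub>C u = (- (\<kappa> * cinner v z)) *\<^sub>C z"
      "B v - complex_of_real t *\<^sub>C v = (- (\<kappa> * cinner u z)) *\<^sub>C z" by blast
    have nz: "(cinner u z, cinner v z) \<noteq> (0, 0)"
      using uv A.cyclic[of u "complex_of_real s"] B.cyclic[of v "complex_of_real t"] by auto
    show ?Q
    proof (rule exI[of _ "cinner u z"], rule exI[of _ "cinner v z"], intro conjI)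
      show "\<exists>u'. A u' - complex_of_real s *\<^sub>C u' = (- (\<kappa> * cinner v z)) *\<^sub>C z \<and> cinner u' z = cinner u z"
        by (rule exI[of _ u]) (rule conjI[OF uv(2) refl])
      show "\<exists>v'. B v' - complex_of_real t *\<^sub>C v' = (- (\<kappa> * cinner u z)) *\<^sub>C z \<and> cinner v' z = cinner v z"
        by (rule exI[of _ v]) (rule conjI[OF uv(3) refl])
    qed (rule nz)
  next
    assume ?Q
    then obtain u v where "(cinner u z, cinner v z) \<noteq> (0, 0)"
      "A u - complex_of_real s *\<^sub>C u = (- (\<kappa> * cinner v z)) *\<^sub>C z"
      "B v - complex_of_real t *\<^sub>C v = (- (\<kappa> * cinner u z)) *\<^sub>C z" by blast
    moreover from this have "(u, v) \<noteq> (0, 0)" by auto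
    ultimately show ?P by (intro exI[of _ u] exI[of _ v] conjI)
  qed
  also have "\<dots> \<longleftrightarrow> (\<exists>(x::complex) (y::complex). (x, y) \<noteq> (0, 0) \<and>
     (if s \<in> hA ` {1..m} then x = 0 else x * A.G s = - (\<kappa> * y)) \<and>
     (if t \<in> hB ` {1..m} then y = 0 else y * B.G t = - (\<kappa> * x)))"
    unfolding A.response B.response ..
  also have "\<dots> \<longleftrightarrow> ?R"
  proof -
    have k: "complex_of_real \<kappa> \<noteq> 0" using \<kappa> by simp
    \<comment> \<open>\<open>f\<close> and \<open>g\<close> stand for the values of the two functions; the fourth fact is the vanishing of the
      determinant of the \<open>2 \<times> 2\<close> system, with \<open>(\<kappa>, - f)\<close> in its kernel.\<close>
    have 1: "(\<exists>(x::complex) (y::complex). (x, y) \<noteq> (0, 0) \<and> x = 0 \<and> y * complex_of_real g = - (\<kappa> * x)) \<longleftrightarrow> g = 0" for g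
      by (auto intro: exI[of _ 1])
    have 2: "(\<exists>(x::complex) (y::complex). (x, y) \<noteq> (0, 0) \<and> x * complex_of_real g = - (\<kappa> * y) \<and> y = 0) \<longleftrightarrow> g = 0" for g
      by (auto intro: exI[of _ 1])
    have 3: "(\<exists>(x::complex) (y::complex). (x, y) \<noteq> (0, 0) \<and> x = 0 \<and> y = (0::complex)) \<longleftrightarrow> False" by auto
    have 4: "(\<exists>(x::complex) (y::complex). (x, y) \<noteq> (0, 0) \<and> x * complex_of_real f = - (\<kappa> * y) \<and> y * complex_of_real g = - (\<kappa> * x))
        \<longleftrightarrow> f * g = \<kappa>\<^sup>2" (is "?l \<longleftrightarrow> _") for f g
    proof
      assume ?l
      then obtain x y :: complex where xy: "(x, y) \<noteq> (0, 0)" "x * f = - (\<kappa> * y)" "y * g = - (\<kappa> * x)" by blast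
      have "x \<noteq> 0" using xy k by auto
      have "x * (complex_of_real f * g) = (x * f) * g" by (simp add: mult.assoc)
      also have "\<dots> = - (\<kappa> * (y * g))" unfolding xy(2) by (simp add: mult.assoc)
      also have "\<dots> = x * (\<kappa> * \<kappa>)" unfolding xy(3) by simp
      finally have "x * (complex_of_real f * g) = x * (\<kappa> * \<kappa>)" .
      then have "complex_of_real (f * g) = complex_of_real (\<kappa> * \<kappa>)" using \<open>x \<noteq> 0\<close> by simp
      then show "f * g = \<kappa>\<^sup>2" unfolding of_real_eq_iff by (simp add: power2_eq_square)
    next
      assume fg: "f * g = \<kappa>\<^sup>2"
      have "complex_of_real f * g = \<kappa> * \<kappa>" using fg by (metis of_real_mult power2_eq_square)
      then show ?l
        using k by (intro exI[of _ "complex_of_real \<kappa>"] exI[of _ "- complex_of_real f"]) auto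
    qed
    show ?thesis
      by (cases "s \<in> hA ` {1..m}"; cases "t \<in> hB ` {1..m}") (simp_all only: if_True if_False 1 2 3 4, simp_all)
  qed
  finally show ?thesis .
qed

text \<open>The operator whose eigenvalues form the curves is \<open>B - \<tau>(s) P\<close>.\<close>

definition \<tau> :: "real \<Rightarrow> real"
  where "\<tau> s = \<kappa>\<^sup>2 * A.recip s"

lemma pair_eigenvalue_iff_branch:
  assumes "s \<notin> A.zero ` {1..Suc m}"
  shows "pair_eigenvalue A B z \<kappa> (complex_of_real s, complex_of_real t) \<longleftrightarrow> (\<exists>k\<le>m. t = B.branch k (\<tau> s))"
proof -
  have "pair_eigenvalue A B z \<kappa> (complex_of_real s, complex_of_real t) \<longleftrightarrow> t \<notin> hB ` {1..m} \<and> B.G t = \<tau> s"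
    using assms \<kappa> unfolding pair_eigenvalue_iff A.zero_iff by (auto simp: \<tau>_def A.recip_def field_simps)
  then show ?thesis using B.G_eq_iff by blast
qed

lemma pair_eigenvalue_iff_zero:
  assumes "s \<in> A.zero ` {1..Suc m}"
  shows "pair_eigenvalue A B z \<kappa> (complex_of_real s, complex_of_real t) \<longleftrightarrow> t \<in> hB ` {1..m}"
  using assms \<kappa> unfolding pair_eigenvalue_iff A.zero_iff by auto

lemma enumerates_schur_iff:
  assumes "s \<notin> A.zero ` {1..Suc m}" "finite I"
  shows "enumerates_eigenvalues UNIV (schur_operator A B z \<kappa> (complex_of_real s)) I e \<longleftrightarrow>
    bij_betw e I ((\<lambda>k. B.branch k (\<tau> s)) ` {..m})"
proof -
  have "schur_operator A B z \<kappa> (complex_of_real s) = (\<lambda>u. B u - (complex_of_real (\<tau> s) * cinner u z) *\<^sub>C z)"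
    using A.cinner_resolvent[of s] assms(1) A.Spec_iff_zero
    by (auto simp: schur_operator_def PZ_eq[OF A.z] \<tau>_def fun_eq_iff mult_ac)
  then show ?thesis using B.enumerates_rank_one_iff[OF assms(2)] by simp
qed

end

context coupled begin

abbreviation "n \<equiv> Suc m"

section \<open>Existence of the eigenvalue curves\<close>

lemma \<tau>_less: "i \<le> n \<Longrightarrow> x \<in> A.zero_gap i \<Longrightarrow> y \<in> A.zero_gap i \<Longrightarrow> x < y \<Longrightarrow> \<tau> x < \<tau> y"
  using A.recip_less \<kappa> by (simp add: \<tau>_def)

lemma \<tau>_isCont: "x \<notin> A.zero ` {1..n} \<Longrightarrow> isCont \<tau> x"
  using A.recip_isCont unfolding \<tau>_def[abs_def] by (intro continuous_intros) auto

lemma \<tau>_at_left: "i \<in> {1..n} \<Longrightarrow> filterlim \<tau> at_top (at_left (A.zero i))"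
  unfolding \<tau>_def[abs_def] using \<kappa>
  by (intro filterlim_tendsto_pos_mult_at_top[OF tendsto_const] A.recip_at_left) auto

lemma \<tau>_at_right: "i \<in> {1..n} \<Longrightarrow> filterlim \<tau> at_bot (at_right (A.zero i))"
  unfolding \<tau>_def[abs_def] using \<kappa>
  by (intro filterlim_tendsto_pos_mult_at_bot[OF tendsto_const] A.recip_at_right) auto

lemma zero_gap_avoids_zeros: "i \<le> n \<Longrightarrow> a \<in> A.zero_gap i \<Longrightarrow> a \<notin> A.zero ` {1..n}"
  using gap_point_notin_cell[OF A.zero_strict_mono] by blast

lemma eventually_zero_gap_left:
  assumes i: "i \<in> {1..n}"
  shows "\<forall>\<^sub>F x in at_left (A.zero i). x \<in> A.zero_gap (i - 1)"
proof -
  obtain x0 where "x0 \<in> A.zero_gap (i - 1)" using cell_nonempty[OF A.zero_strict_mono, of "i - 1"] i by fastforce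
  then have x0: "x0 < A.zero i" "0 < i - 1 \<longrightarrow> A.zero (i - 1) < x0" using i by (auto simp: cell_def)
  have "\<forall>\<^sub>F x in at_left (A.zero i). x \<in> {x0<..<A.zero i}" by (rule eventually_at_left_real[OF x0(1)])
  then show ?thesis by (rule eventually_mono) (use i x0 in \<open>auto simp: cell_def\<close>)
qed

lemma eventually_zero_gap_right:
  assumes i: "i \<in> {1..n}"
  shows "\<forall>\<^sub>F x in at_right (A.zero i). x \<in> A.zero_gap i"
proof -
  obtain x0 where "x0 \<in> A.zero_gap i" using cell_nonempty[OF A.zero_strict_mono, of i] i by fastforce
  then have x0: "A.zero i < x0" "i < n \<longrightarrow> x0 < A.zero (Suc i)" using i by (auto simp: cell_def)
  have "\<forall>\<^sub>F x in at_right (A.zero i). x \<in> {A.zero i<..<x0}" by (rule eventually_at_right_real[OF x0(1)])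
  then show ?thesis by (rule eventually_mono) (use i x0 in \<open>auto simp: cell_def\<close>)
qed

text \<open>A function that follows branch \<open>k\<close> on the left of an eigenvalue of \<open>A\<close> sees \<open>\<tau>\<close> tend to \<open>+\<infinity>\<close> there, so
it tends to the left end of the \<open>k\<close>-th interval of \<open>B\<close>; on the right of the eigenvalue (next lemma)
\<open>\<tau>\<close> comes from \<open>-\<infinity>\<close> and the limit is the right end.\<close>

lemma curve_left:
  assumes i: "i \<in> {1..n}" and k: "k \<le> m" and f: "\<And>a. a \<in> A.zero_gap (i - 1) \<Longrightarrow> f a = B.branch k (\<tau> a)"
  shows "k = 0 \<Longrightarrow> filterlim f at_bot (at_left (A.zero i))"
    and "0 < k \<Longrightarrow> (f \<longlongrightarrow> hB k) (at_left (A.zero i))"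
proof -
  have ev: "\<forall>\<^sub>F x in at_left (A.zero i). B.branch k (\<tau> x) = f x"
    using eventually_zero_gap_left[OF i] by (rule eventually_mono) (simp add: f)
  show "filterlim f at_bot (at_left (A.zero i))" if "k = 0"
    by (rule filterlim_mono_eventually[OF filterlim_compose[OF B.branch_0_at_top \<tau>_at_left[OF i]]
          order_refl order_refl ev[unfolded that]])
  show "(f \<longlongrightarrow> hB k) (at_left (A.zero i))" if "0 < k"
    by (rule Lim_transform_eventually[OF filterlim_compose[OF B.branch_at_top[OF k that] \<tau>_at_left[OF i]] ev])
qed

lemma curve_right:
  assumes i: "i \<in> {1..n}" and k: "k \<le> m" and f: "\<And>a. a \<in> A.zero_gap i \<Longrightarrow> f a = B.branch k (\<tau> a)"
  shows "k = m \<Longrightarrow> filterlim f at_top (at_right (A.zero i))"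
    and "k < m \<Longrightarrow> (f \<longlongrightarrow> hB (Suc k)) (at_right (A.zero i))"
proof -
  have ev: "\<forall>\<^sub>F x in at_right (A.zero i). B.branch k (\<tau> x) = f x"
    using eventually_zero_gap_right[OF i] by (rule eventually_mono) (simp add: f)
  show "filterlim f at_top (at_right (A.zero i))" if "k = m"
    by (rule filterlim_mono_eventually[OF filterlim_compose[OF B.branch_m_at_bot \<tau>_at_right[OF i]]
          order_refl order_refl ev[unfolded that]])
  show "(f \<longlongrightarrow> hB (Suc k)) (at_right (A.zero i))" if "k < m"
    by (rule Lim_transform_eventually[OF filterlim_compose[OF B.branch_at_bot[OF that] \<tau>_at_right[OF i]] ev])
qed

text \<open>Reduces the curves to real analysis: only the branches of \<open>B\<close>, the zeros of \<open>A\<close> and the function \<open>\<tau>\<close> remain.\<close>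

lemma eigenvalue_curves_iff:
  "eigenvalue_curves A B z \<kappa> n D b \<longleftrightarrow>
    (\<forall>a. a \<notin> A.zero ` {1..n} \<longrightarrow> (\<forall>c\<in>{1..n}. a \<in> D c) \<and>
       bij_betw (\<lambda>c. b c a) {1..n} ((\<lambda>k. B.branch k (\<tau> a)) ` {..m})) \<and>
    (\<forall>c\<in>{1..n}. continuous_on (D c) (b c) \<and>
       (\<forall>i\<in>{1..n}.
          (\<forall>l. (b c \<longlongrightarrow> l) (at_left (A.zero i)) \<or> (b c \<longlongrightarrow> l) (at_right (A.zero i)) \<longrightarrow>
             A.zero i \<in> D c \<and> b c (A.zero i) = l) \<and>
          (filterlim (b c) at_bot (at_left (A.zero i)) \<longleftrightarrow> filterlim (b c) at_top (at_right (A.zero i)))))"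
proof -
  have 1: "(\<forall>a. complex_of_real a \<notin> Spec A \<longrightarrow>
       (\<forall>c\<in>{1..n}. a \<in> D c) \<and>
       enumerates_eigenvalues UNIV (schur_operator A B z \<kappa> (complex_of_real a)) {1..n} (\<lambda>c. b c a)) \<longleftrightarrow>
     (\<forall>a. a \<notin> A.zero ` {1..n} \<longrightarrow> (\<forall>c\<in>{1..n}. a \<in> D c) \<and>
       bij_betw (\<lambda>c. b c a) {1..n} ((\<lambda>k. B.branch k (\<tau> a)) ` {..m}))"
    using enumerates_schur_iff[OF _ finite_atLeastAtMost] unfolding A.Spec_iff_zero by blast
  have 2: "(\<forall>a. a \<in> A.zero ` {1..n} \<longrightarrow> P a) \<longleftrightarrow> (\<forall>i\<in>{1..n}. P (A.zero i))" for P by blast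
  show ?thesis unfolding eigenvalue_curves_def 1 unfolding A.Spec_iff_zero 2 ..
qed

end

text \<open>Shows that the curves constructed below occupy different branches on each interval.\<close>

lemma shift_mod_bij:
  "bij_betw (\<lambda>c. (c + y) mod Suc m) {1..Suc m} {..m}"
proof -
  have "inj_on (\<lambda>c. (c + y) mod Suc m) {1..Suc m}"
  proof (rule linorder_inj_onI)
    fix c c' assume c: "c < c'" "c \<in> {1..Suc m}" "c' \<in> {1..Suc m}"
    have "\<not> Suc m dvd (c' + y) - (c + y)"
      using c by (auto dest!: dvd_imp_le)
    then show "(c + y) mod Suc m \<noteq> (c' + y) mod Suc m"
      using mod_eq_dvd_iff_nat[of "c + y" "c' + y" "Suc m"] c by auto
  qed auto
  moreover have "(\<lambda>c. (c + y) mod Suc m) ` {1..Suc m} = {..m}"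
  proof (rule card_subset_eq)
    show "card ((\<lambda>c. (c + y) mod Suc m) ` {1..Suc m}) = card {..m}"
      using calculation by (simp add: card_image)
  qed (auto simp: less_Suc_eq_le[symmetric])
  ultimately show ?thesis by (simp add: bij_betw_def)
qed

context coupled begin

text \<open>The branch that curve \<open>c\<close> follows on the \<open>i\<close>-th interval between eigenvalues of \<open>A\<close>. It drops by one,
cyclically, at every eigenvalue of \<open>A\<close>; \<open>n - i\<close> stands for \<open>- i\<close>, so that the numbers stay
natural.\<close>

definition level :: "nat \<Rightarrow> nat \<Rightarrow> nat"
  where "level c i = (c + (n - i)) mod n"

lemma level_le: "level c i \<le> m"
  by (simp add: level_def less_Suc_eq_le[symmetric])

lemma level_step: "i \<in> {1..n} \<Longrightarrow> level c (i - 1) = (if level c i = m then 0 else Suc (level c i))"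
proof -
  assume "i \<in> {1..n}"
  then have "c + (n - (i - 1)) = Suc (c + (n - i))" by auto
  then show ?thesis unfolding level_def by (simp only: mod_Suc) auto
qed

definition index :: "real \<Rightarrow> nat"
  where "index a = (THE i. i \<le> n \<and> a \<in> A.zero_gap i)"

lemma index_eq: "i \<le> n \<Longrightarrow> a \<in> A.zero_gap i \<Longrightarrow> index a = i"
  unfolding index_def using cell_unique[OF A.zero_strict_mono] by blast

text \<open>At an eigenvalue of \<open>A\<close> where the curve is not extended the value is arbitrary.\<close>

definition the_curve :: "nat \<Rightarrow> real \<Rightarrow> real"
  where "the_curve c a = (if a \<in> A.zero ` {1..n}
     then hB (level c (inv_into {1..n} A.zero a - 1)) else B.branch (level c (index a)) (\<tau> a))"

definition the_domain :: "nat \<Rightarrow> real set"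
  where "the_domain c = - A.zero ` {i \<in> {1..n}. level c (i - 1) = 0}"

lemma the_curve_on_zero_gap: "i \<le> n \<Longrightarrow> a \<in> A.zero_gap i \<Longrightarrow> the_curve c a = B.branch (level c i) (\<tau> a)"
  using zero_gap_avoids_zeros index_eq by (simp add: the_curve_def)

lemma the_curve_zero: "i \<in> {1..n} \<Longrightarrow> the_curve c (A.zero i) = hB (level c (i - 1))"
  using inv_into_f_f[OF strict_mono_on_imp_inj_on[OF A.zero_strict_mono], of i] by (simp add: the_curve_def)

lemma zero_in_domain_iff: "i \<in> {1..n} \<Longrightarrow> A.zero i \<in> the_domain c \<longleftrightarrow> level c (i - 1) \<noteq> 0"
  using strict_mono_on_imp_inj_on[OF A.zero_strict_mono] by (auto simp: the_domain_def dest: inj_onD)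

lemma the_curve_at_left:
  assumes i: "i \<in> {1..n}"
  shows "level c (i - 1) = 0 \<Longrightarrow> filterlim (the_curve c) at_bot (at_left (A.zero i))"
    and "level c (i - 1) \<noteq> 0 \<Longrightarrow> (the_curve c \<longlongrightarrow> the_curve c (A.zero i)) (at_left (A.zero i))"
  using curve_left[OF i level_le, of "the_curve c" c "i - 1"] the_curve_on_zero_gap[of "i - 1" _ c] the_curve_zero[OF i] i by auto

lemma the_curve_at_right:
  assumes i: "i \<in> {1..n}"
  shows "level c (i - 1) = 0 \<Longrightarrow> filterlim (the_curve c) at_top (at_right (A.zero i))"
    and "level c (i - 1) \<noteq> 0 \<Longrightarrow> (the_curve c \<longlongrightarrow> the_curve c (A.zero i)) (at_right (A.zero i))"
  using curve_right[OF i level_le, of "the_curve c" c i] the_curve_on_zero_gap[of i _ c] the_curve_zero[OF i] i level_le[of c i]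
    level_step[OF i, of c] by (auto split: if_splits)

lemma branch_\<tau>_isCont: "k \<le> m \<Longrightarrow> a \<notin> A.zero ` {1..n} \<Longrightarrow> isCont (\<lambda>a. B.branch k (\<tau> a)) a"
  using isCont_o2[OF \<tau>_isCont B.branch_isCont] by blast

lemma isCont_on_zero_gap:
  assumes "i \<le> n" "k \<le> m" "\<And>a. a \<in> A.zero_gap i \<Longrightarrow> f a = B.branch k (\<tau> a)" "a \<in> A.zero_gap i"
  shows "isCont f a"
proof -
  have "\<forall>\<^sub>F x in nhds a. f x = B.branch k (\<tau> x)"
    using eventually_nhds_in_open[OF open_cell assms(4)] by (rule eventually_mono) (rule assms(3))
  from isCont_cong[OF this] show ?thesis
    using branch_\<tau>_isCont[OF assms(2)] zero_gap_avoids_zeros assms by blast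
qed

lemma eigenvalue_curves_exist: "eigenvalue_curves A B z \<kappa> n the_domain the_curve"
  unfolding eigenvalue_curves_iff
proof (intro conjI ballI allI impI)
  fix a assume a: "a \<notin> A.zero ` {1..n}"
  show "a \<in> the_domain c" for c using a by (auto simp: the_domain_def)
  obtain i where i: "i \<le> n" "a \<in> A.zero_gap i" using cell_cover[OF a] .
  have "bij_betw (\<lambda>c. level c i) {1..n} {..m}" unfolding level_def by (rule shift_mod_bij)
  moreover have "bij_betw (\<lambda>k. B.branch k (\<tau> a)) {..m} ((\<lambda>k. B.branch k (\<tau> a)) ` {..m})"
    using B.branch_inj by (intro inj_on_imp_bij_betw inj_onI) auto
  ultimately have "bij_betw ((\<lambda>k. B.branch k (\<tau> a)) \<circ> (\<lambda>c. level c i)) {1..n} ((\<lambda>k. B.branch k (\<tau> a)) ` {..m})"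
    by (rule bij_betw_trans)
  then show "bij_betw (\<lambda>c. the_curve c a) {1..n} ((\<lambda>k. B.branch k (\<tau> a)) ` {..m})"
    using the_curve_on_zero_gap[OF i] by (simp add: comp_def)
next
  fix c assume "c \<in> {1..n}"
  show "continuous_on (the_domain c) (the_curve c)"
  proof (rule continuous_at_imp_continuous_on, rule ballI)
    fix a assume a: "a \<in> the_domain c"
    show "isCont (the_curve c) a"
    proof (cases "a \<in> A.zero ` {1..n}")
      case True
      then obtain i where i: "i \<in> {1..n}" "a = A.zero i" by blast
      then have "level c (i - 1) \<noteq> 0" using a zero_in_domain_iff by blast
      then show ?thesis unfolding isCont_def filterlim_split_at[of "the_curve c"]
        using the_curve_at_left(2)[OF i(1)] the_curve_at_right(2)[OF i(1)] i(2) filterlim_split_at by blast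
    next
      case False
      obtain i where i: "i \<le> n" "a \<in> A.zero_gap i" using cell_cover[OF False] .
      show ?thesis by (rule isCont_on_zero_gap[OF i(1) level_le the_curve_on_zero_gap[OF i(1)] i(2)])
    qed
  qed
next
  fix c i l assume i: "i \<in> {1..n}"
    and l: "(the_curve c \<longlongrightarrow> l) (at_left (A.zero i)) \<or> (the_curve c \<longlongrightarrow> l) (at_right (A.zero i))"
  have nz: "level c (i - 1) \<noteq> 0"
  proof
    assume "level c (i - 1) = 0"
    then show False
      using l the_curve_at_left(1)[OF i] the_curve_at_right(1)[OF i]
        not_tendsto_and_filterlim_at_infinity[OF trivial_limit_at_left_real, of "the_curve c" l "A.zero i"]
        not_tendsto_and_filterlim_at_infinity[OF trivial_limit_at_right_real, of "the_curve c" l "A.zero i"]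
        filterlim_mono[OF _ at_bot_le_at_infinity order_refl] filterlim_mono[OF _ at_top_le_at_infinity order_refl] by blast
  qed
  then show "A.zero i \<in> the_domain c" using i zero_in_domain_iff by blast
  show "the_curve c (A.zero i) = l"
    using l the_curve_at_left(2)[OF i nz] the_curve_at_right(2)[OF i nz]
      tendsto_unique[OF trivial_limit_at_left_real] tendsto_unique[OF trivial_limit_at_right_real] by blast
next
  fix c i assume i: "i \<in> {1..n}"
  show "filterlim (the_curve c) at_bot (at_left (A.zero i)) \<longleftrightarrow> filterlim (the_curve c) at_top (at_right (A.zero i))"
  proof (cases "level c (i - 1) = 0")
    case True
    then show ?thesis using the_curve_at_left(1)[OF i] the_curve_at_right(1)[OF i] by blast
  next
    case False
    then show ?thesis
      using the_curve_at_left(2)[OF i False] the_curve_at_right(2)[OF i False]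
        not_tendsto_and_filterlim_at_infinity[OF trivial_limit_at_left_real, of "the_curve c" _ "A.zero i"]
        not_tendsto_and_filterlim_at_infinity[OF trivial_limit_at_right_real, of "the_curve c" _ "A.zero i"]
        filterlim_mono[OF _ at_bot_le_at_infinity order_refl] filterlim_mono[OF _ at_top_le_at_infinity order_refl] by blast
  qed
qed

end

context pick_function begin

section \<open>The grid of rectangles\<close>

text \<open>The grid points are alternately zeros and poles, starting with a zero. After a pole, or from \<open>-\<infinity>\<close> on,
\<open>G\<close> is positive up to the next zero, and after a zero it is negative up to the next pole.\<close>

lemma grid_cell:
  assumes e: "\<And>j. j \<in> {1..Suc m} \<Longrightarrow> e j = zero j" and p: "p \<in> {1..2 * Suc m}"
    and s: "grid (Suc m) e h (p - 1) < ereal s" "ereal s < grid (Suc m) e h p"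
  shows "s \<notin> h ` {1..m}" and "if odd p then 0 < G s else G s < 0"
proof -
  have "s \<notin> h ` {1..m} \<and> (if odd p then 0 < G s else G s < 0)"
  proof (cases "odd p")
    case True
    then obtain k where k: "p = 2 * k + 1" by (rule oddE)
    then have km: "k \<le> m" using p by auto
    have z: "zero (Suc k) \<in> pole_gap k" using zero_in[of "Suc k"] km by simp
    have "s < zero (Suc k)" using s(2) km e[of "Suc k"] by (auto simp: grid_def k)
    moreover have "0 < k \<longrightarrow> h k < s" using s(1) km by (auto simp: grid_def k)
    ultimately have pole_gap: "s \<in> pole_gap k" using z by (auto simp: cell_def)
    have "0 < G s" using less_branch_iff[OF km pole_gap, of 0] \<open>s < zero (Suc k)\<close> by (simp add: zero_def)
    then show ?thesis using True pole_gap_avoids_poles[OF km pole_gap] by simp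
  next
    case False
    then obtain k where k: "p = 2 * k" by (auto elim: evenE)
    then have km: "1 \<le> k" "k \<le> Suc m" using p by auto
    have p1: "odd (p - 1)" "(p - 1 + 1) div 2 = k" "p - 1 \<noteq> 2 * Suc m" "p - 1 \<noteq> 0" using k km by auto
    have z: "zero k \<in> pole_gap (k - 1)" using zero_in[of k] km by simp
    have "zero k < s" using s(1) km e[of k] p1 by (auto simp: grid_def)
    moreover have "k \<le> m \<longrightarrow> s < h k" using s(2) km by (auto simp: grid_def k)
    ultimately have pole_gap: "s \<in> pole_gap (k - 1)" using z km by (auto simp: cell_def)
    have "G s < 0" using branch_less_iff[of "k - 1" s 0] pole_gap km \<open>zero k < s\<close> by (simp add: zero_def)
    then show ?thesis using False pole_gap_avoids_poles[of "k - 1" s] pole_gap km by simp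
  qed
  then show "s \<notin> h ` {1..m}" "if odd p then 0 < G s else G s < 0" by simp_all
qed

end

lemma grid_odd: "j \<in> {1..n} \<Longrightarrow> grid n e h (2 * j - 1) = ereal (e j)"
proof -
  assume j: "j \<in> {1..n}"
  then have "odd (2 * j - 1)" "(2 * j - 1 + 1) div 2 = j" "2 * j - 1 \<noteq> 2 * n" "2 * j - 1 \<noteq> 0" by auto
  then show ?thesis by (auto simp: grid_def)
qed

lemma grid_even: "k \<in> {1..n - 1} \<Longrightarrow> grid n e h (2 * k) = ereal (h k)"
  by (auto simp: grid_def)

lemma grid_gap_or_value:
  fixes s :: real
  assumes n: "0 < n"
  obtains p where "p \<in> {1..2 * n}" "grid n e h (p - 1) < ereal s" "ereal s < grid n e h p"
    | "s \<in> e ` {1..n} \<union> h ` {1..n - 1}"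
proof -
  let ?x = "grid n e h"
  define p where "p = (LEAST p. ereal s < ?x p)"
  have top: "ereal s < ?x (2 * n)" using n by (simp add: grid_def)
  have p: "ereal s < ?x p" "p \<le> 2 * n"
    using LeastI[of "\<lambda>p. ereal s < ?x p", OF top] Least_le[of "\<lambda>p. ereal s < ?x p", OF top] by (simp_all add: p_def)
  have p0: "p \<noteq> 0" using p by (auto simp: grid_def intro: ccontr)
  then have le: "?x (p - 1) \<le> ereal s"
    using not_less_Least[of "p - 1" "\<lambda>p. ereal s < ?x p"] by (simp add: p_def not_less)
  show thesis
  proof (cases "?x (p - 1) = ereal s")
    case True
    define i where "i = p - 1"
    have i: "?x i = ereal s" "i < 2 * n" "i \<noteq> 0" using True p p0 by (auto simp: i_def grid_def)
    have "s \<in> e ` {1..n} \<union> h ` {1..n - 1}"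
    proof (cases "odd i")
      case True
      then have "s = e ((i + 1) div 2)" "(i + 1) div 2 \<in> {1..n}" using i by (auto simp: grid_def)
      then show ?thesis by blast
    next
      case False
      then have "s = h (i div 2)" "i div 2 \<in> {1..n - 1}" using i by (auto simp: grid_def elim!: evenE)
      then show ?thesis by blast
    qed
    then show thesis by (rule that(2))
  next
    case False
    then show thesis using that(1)[of p] p p0 le by simp
  qed
qed

text \<open>Splitting at an exceptional point reduces the claim to intervals with fewer of them; an interval
without such points is handled by letting the arguments tend to its ends.\<close>

lemma decreasing_across_finite_set:
  fixes f :: "real \<Rightarrow> real"
  assumes S: "finite S" and cont: "continuous_on {x..y} f" and xy: "x < y"
    and dec: "\<And>u v. x < u \<Longrightarrow> u < v \<Longrightarrow> v < y \<Longrightarrow> {u..v} \<inter> S = {} \<Longrightarrow> f v < f u"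
  shows "f y < f x"
  using cont xy dec
proof (induction "card (S \<inter> {x<..<y})" arbitrary: x y rule: less_induct)
  case (less x y)
  show ?case
  proof (cases "S \<inter> {x<..<y} = {}")
    case True
    have dec: "f v < f u" if "x < u" "u < v" "v < y" for u v
      using less.prems(3)[OF that] True that by fastforce
    \<comment> \<open>\<open>f y \<le> f q < f p \<le> f x\<close>; the two interior points make the inequality strict.\<close>
    define p q where "p = (2 * x + y) / 3" and "q = (x + 2 * y) / 3"
    have pq: "x < p" "p < q" "q < y" using less.prems(2) by (auto simp: p_def q_def field_simps)
    have "(f \<longlongrightarrow> f x) (at_right x)"
      by (rule continuous_on_Icc_at_rightD[OF less.prems(1,2)])
    moreover have "\<forall>\<^sub>F u in at_right x. u \<in> {x<..<p}" by (rule eventually_at_right_real[OF pq(1)])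
    then have "\<forall>\<^sub>F u in at_right x. f p \<le> f u"
      by (rule eventually_mono) (use dec pq in \<open>auto intro!: less_imp_le\<close>)
    ultimately have "f p \<le> f x" by (rule tendsto_lowerbound) simp
    have "(f \<longlongrightarrow> f y) (at_left y)"
      by (rule continuous_on_Icc_at_leftD[OF less.prems(1,2)])
    moreover have "\<forall>\<^sub>F u in at_left y. u \<in> {q<..<y}" by (rule eventually_at_left_real[OF pq(3)])
    then have "\<forall>\<^sub>F u in at_left y. f u \<le> f q"
      by (rule eventually_mono) (use dec pq in \<open>auto intro!: less_imp_le\<close>)
    ultimately have "f y \<le> f q" by (rule tendsto_upperbound) simp
    then show ?thesis using \<open>f p \<le> f x\<close> dec[OF pq] by simp
  next
    case False
    then obtain s where s: "s \<in> S" "x < s" "s < y" by auto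
    have "f s < f x"
    proof (rule less.hyps)
      show "card (S \<inter> {x<..<s}) < card (S \<inter> {x<..<y})"
        by (rule psubset_card_mono) (use S s in auto)
      show "continuous_on {x..s} f" using s by (auto intro: continuous_on_subset[OF less.prems(1)])
    qed (use s less.prems(3) in auto)
    moreover have "f y < f s"
    proof (rule less.hyps)
      show "card (S \<inter> {s<..<y}) < card (S \<inter> {x<..<y})"
        by (rule psubset_card_mono) (use S s in auto)
      show "continuous_on {s..y} f" using s by (auto intro: continuous_on_subset[OF less.prems(1)])
    qed (use s less.prems(3) in auto)
    ultimately show ?thesis by simp
  qed
qed

lemma at_within_le_at_within:
  assumes "\<forall>\<^sub>F y in at x within S. y \<in> T"
  shows "at x within S \<le> at x within T"
  unfolding le_filter_def
proof (intro allI impI)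
  fix P assume "eventually P (at x within T)"
  then have "\<forall>\<^sub>F y in nhds x. y \<noteq> x \<longrightarrow> y \<in> T \<longrightarrow> P y" by (simp add: eventually_at_filter)
  moreover have "\<forall>\<^sub>F y in nhds x. y \<noteq> x \<longrightarrow> y \<in> S \<longrightarrow> y \<in> T"
    using assms by (simp add: eventually_at_filter)
  ultimately have "\<forall>\<^sub>F y in nhds x. y \<noteq> x \<longrightarrow> y \<in> S \<longrightarrow> P y" by eventually_elim blast
  then show "eventually P (at x within S)" by (simp add: eventually_at_filter)
qed

context coupled begin

lemma pair_eigenvalue_cases:
  assumes "pair_eigenvalue A B z \<kappa> (complex_of_real s, complex_of_real t)"
  obtains "s \<in> hA ` {1..m}" "t \<in> B.zero ` {1..n}"
    | "s \<in> A.zero ` {1..n}" "t \<in> hB ` {1..m}"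
    | "s \<notin> hA ` {1..m} \<union> A.zero ` {1..n}" "t \<notin> hB ` {1..m} \<union> B.zero ` {1..n}" "0 < A.G s * B.G t"
proof -
  have "0 < \<kappa>\<^sup>2" using \<kappa> by simp
  then show thesis using assms that unfolding pair_eigenvalue_iff A.zero_iff B.zero_iff Un_iff
    by (metis less_irrefl mult_eq_0_iff)
qed

lemma pair_eigenvalue_rectangle:
  assumes eA: "\<And>j. j \<in> {1..n} \<Longrightarrow> eA j = A.zero j" and eB: "\<And>j. j \<in> {1..n} \<Longrightarrow> eB j = B.zero j"
    and pair: "pair_eigenvalue A B z \<kappa> (complex_of_real s, complex_of_real t)"
    and p: "p \<in> {1..2 * n}" and q: "q \<in> {1..2 * n}"
    and R: "(s, t) \<in> rectangle (grid n eA hA) (grid n eB hB) p q"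
  shows "even (p + q)"
proof -
  have "grid n eA hA (p - 1) < ereal s" "ereal s < grid n eA hA p"
    "grid n eB hB (q - 1) < ereal t" "ereal t < grid n eB hB q"
    using R by (auto simp: rectangle_def)
  note a = A.grid_cell[OF eA p this(1,2)] and b = B.grid_cell[OF eB q this(3,4)]
  have "s \<notin> hA ` {1..m}" "t \<notin> hB ` {1..m}" using a b by simp_all
  with pair have "0 < A.G s * B.G t" by (cases rule: pair_eigenvalue_cases) simp_all
  then show ?thesis using a(2) b(2) by (auto simp: zero_less_mult_iff split: if_splits)
qed

text \<open>In the third case of \<open>pair_eigenvalue_cases\<close> both coordinates avoid the grid points and the pair lies
in a rectangle; the other two cases pair a pole with a zero, that is, an even with an odd index.\<close>

lemma pair_eigenvalue_corner:
  assumes eA: "\<And>j. j \<in> {1..n} \<Longrightarrow> eA j = A.zero j" and eB: "\<And>j. j \<in> {1..n} \<Longrightarrow> eB j = B.zero j"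
    and pair: "pair_eigenvalue A B z \<kappa> (complex_of_real s, complex_of_real t)"
    and R: "(s, t) \<notin> (\<Union>p\<in>{1..2*n}. \<Union>q\<in>{1..2*n}. rectangle (grid n eA hA) (grid n eB hB) p q)"
  shows "\<exists>i\<le>2*n. \<exists>j\<le>2*n. odd (i + j) \<and> ereal s = grid n eA hA i \<and> ereal t = grid n eB hB j"
proof -
  have odd: "odd (2 * j - 1 + 2 * k)" "odd (2 * k + (2 * j - 1))" if "j \<in> {1..n}" for j k :: nat
    using that by (auto simp: even_diff_nat)
  from pair show ?thesis
  proof (cases rule: pair_eigenvalue_cases)
    case 1
    then obtain k j where kj: "k \<in> {1..m}" "s = hA k" "j \<in> {1..n}" "t = B.zero j" by blast
    then have "ereal s = grid n eA hA (2 * k)" "ereal t = grid n eB hB (2 * j - 1)"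
      using grid_even[of k n eA hA] grid_odd[OF kj(3), of eB hB] eB by simp_all
    moreover have "2 * k \<le> 2 * n" "2 * j - 1 \<le> 2 * n" using kj by auto
    ultimately show ?thesis using odd[OF kj(3)] by blast
  next
    case 2
    then obtain k j where kj: "k \<in> {1..m}" "t = hB k" "j \<in> {1..n}" "s = A.zero j" by blast
    then have "ereal t = grid n eB hB (2 * k)" "ereal s = grid n eA hA (2 * j - 1)"
      using grid_even[of k n eB hB] grid_odd[OF kj(3), of eA hA] eA by simp_all
    moreover have "2 * k \<le> 2 * n" "2 * j - 1 \<le> 2 * n" using kj by auto
    ultimately show ?thesis using odd[OF kj(3)] by blast
  next
    case 3
    have "eA ` {1..n} = A.zero ` {1..n}" "eB ` {1..n} = B.zero ` {1..n}"
      using eA eB by (auto intro!: image_cong)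
    then have "s \<notin> eA ` {1..n} \<union> hA ` {1..n - 1}" "t \<notin> eB ` {1..n} \<union> hB ` {1..n - 1}"
      using 3 by auto
    then obtain p q where pq: "p \<in> {1..2 * n}" "grid n eA hA (p - 1) < ereal s" "ereal s < grid n eA hA p"
      "q \<in> {1..2 * n}" "grid n eB hB (q - 1) < ereal t" "ereal t < grid n eB hB q"
      using grid_gap_or_value[of n eA hA s] grid_gap_or_value[of n eB hB t] by (metis zero_less_Suc)
    then have "(s, t) \<in> (\<Union>p\<in>{1..2*n}. \<Union>q\<in>{1..2*n}. rectangle (grid n eA hA) (grid n eB hB) p q)"
      by (intro UN_I[OF pq(1)] UN_I[OF pq(4)]) (use pq in \<open>simp add: rectangle_def\<close>)
    then show ?thesis using R by blast
  qed
qed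

context
  fixes D :: "nat \<Rightarrow> real set" and b :: "nat \<Rightarrow> real \<Rightarrow> real"
  assumes curves: "eigenvalue_curves A B z \<kappa> n D b"
begin

section \<open>Arbitrary families of eigenvalue curves\<close>

lemma domain_off_spectrum: "a \<notin> A.zero ` {1..n} \<Longrightarrow> c \<in> {1..n} \<Longrightarrow> a \<in> D c"
  and b_bij: "a \<notin> A.zero ` {1..n} \<Longrightarrow> bij_betw (\<lambda>c. b c a) {1..n} ((\<lambda>k. B.branch k (\<tau> a)) ` {..m})"
  using curves unfolding eigenvalue_curves_iff by blast+

lemma b_cont: "c \<in> {1..n} \<Longrightarrow> continuous_on (D c) (b c)"
  using curves unfolding eigenvalue_curves_iff by blast

lemma b_extends:
  "c \<in> {1..n} \<Longrightarrow> i \<in> {1..n} \<Longrightarrow> (b c \<longlongrightarrow> l) (at_left (A.zero i)) \<Longrightarrow> A.zero i \<in> D c \<and> b c (A.zero i) = l"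
  and b_blows: "c \<in> {1..n} \<Longrightarrow> i \<in> {1..n} \<Longrightarrow>
    filterlim (b c) at_bot (at_left (A.zero i)) \<Longrightarrow> filterlim (b c) at_top (at_right (A.zero i))"
  using curves unfolding eigenvalue_curves_iff by blast+

text \<open>The values of the curve are eigenvalues of \<open>B - \<tau>(a) P\<close> and hence avoid the poles of \<open>B\<close>. So the image of
the interval under the curve is a connected set between two consecutive poles.\<close>

lemma ex_label:
  assumes c: "c \<in> {1..n}" and i: "i \<le> n"
  shows "\<exists>k\<le>m. \<forall>a\<in>A.zero_gap i. b c a = B.branch k (\<tau> a)"
proof -
  have br: "\<exists>k\<le>m. b c a = B.branch k (\<tau> a)" if "a \<in> A.zero_gap i" for a
    using bij_betwE[OF b_bij[OF zero_gap_avoids_zeros[OF i that]]] c by fastforce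
  have "continuous_on (A.zero_gap i) (b c)"
    using continuous_on_subset[OF b_cont[OF c]] domain_off_spectrum[OF zero_gap_avoids_zeros[OF i] c] by blast
  then have "connected (b c ` A.zero_gap i)" by (intro connected_continuous_image connected_cell)
  moreover have "b c ` A.zero_gap i \<inter> hB ` {1..m} = {}"
    using br B.branch_in B.pole_gap_avoids_poles by fastforce
  ultimately obtain k where k: "k \<le> m" "b c ` A.zero_gap i \<subseteq> B.pole_gap k"
    using connected_avoid_subset_cell[OF _ _ B.h] by blast
  have "b c a = B.branch k (\<tau> a)" if a: "a \<in> A.zero_gap i" for a
  proof -
    obtain k' where k': "k' \<le> m" "b c a = B.branch k' (\<tau> a)" using br[OF a] by blast
    have "k' = k" using cell_unique[OF B.h k'(1) k(1), of "b c a"] B.branch_in[OF k'(1), of "\<tau> a"] k' k(2) a by auto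
    then show ?thesis using k' by simp
  qed
  then show ?thesis using k by blast
qed

definition label :: "nat \<Rightarrow> nat \<Rightarrow> nat"
  where "label c i = (SOME k. k \<le> m \<and> (\<forall>a\<in>A.zero_gap i. b c a = B.branch k (\<tau> a)))"

lemma label_le: "c \<in> {1..n} \<Longrightarrow> i \<le> n \<Longrightarrow> label c i \<le> m"
  and b_label: "c \<in> {1..n} \<Longrightarrow> i \<le> n \<Longrightarrow> a \<in> A.zero_gap i \<Longrightarrow> b c a = B.branch (label c i) (\<tau> a)"
  using someI_ex[OF ex_label[of c i]] unfolding label_def by auto

text \<open>The eigenvalues at one point of the interval are distinct and each belongs to exactly one curve.\<close>

lemma label_bij:
  assumes i: "i \<le> n" shows "bij_betw (\<lambda>c. label c i) {1..n} {..m}"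
proof -
  obtain a where a: "a \<in> A.zero_gap i" using cell_nonempty[OF A.zero_strict_mono i] by blast
  note bij = b_bij[OF zero_gap_avoids_zeros[OF i a]]
  have "inj_on (\<lambda>c. label c i) {1..n}"
    using b_label[OF _ i a] bij_betw_imp_inj_on[OF bij] by (intro inj_onI) (metis inj_onD)
  moreover have "k \<in> (\<lambda>c. label c i) ` {1..n}" if k: "k \<le> m" for k
  proof -
    have "B.branch k (\<tau> a) \<in> (\<lambda>c. b c a) ` {1..n}" using bij k by (auto simp: bij_betw_def)
    then obtain c where c: "c \<in> {1..n}" "B.branch k (\<tau> a) = b c a" by blast
    then have "k = label c i" using B.branch_inj[OF k label_le[OF c(1) i]] b_label[OF c(1) i a] by simp
    then show ?thesis using c by blast
  qed
  ultimately show ?thesis using label_le[OF _ i] by (auto simp: bij_betw_def)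
qed

lemma tendsto_b:
  assumes c: "c \<in> {1..n}" and a: "a \<in> D c" and S: "\<forall>\<^sub>F y in at a within S. y \<in> D c"
  shows "(b c \<longlongrightarrow> b c a) (at a within S)"
  using b_cont[OF c] a tendsto_mono[OF at_within_le_at_within[OF S]] unfolding continuous_on_def by blast

lemma eventually_D:
  assumes c: "c \<in> {1..n}" shows "\<forall>\<^sub>F y in at a within S. y \<in> D c"
proof -
  have "open (- (A.zero ` {1..n} - {a}))" by (intro open_Compl finite_imp_closed) auto
  then have "\<forall>\<^sub>F y in nhds a. y \<in> - (A.zero ` {1..n} - {a})" by (rule eventually_nhds_in_open) simp
  then show ?thesis unfolding eventually_at_filter
    by (rule eventually_mono) (use domain_off_spectrum[OF _ c] in auto)
qed

lemma b_isCont: "c \<in> {1..n} \<Longrightarrow> a \<in> D c \<Longrightarrow> isCont (b c) a"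
  unfolding isCont_def by (rule tendsto_b[OF _ _ eventually_D])

text \<open>A curve on branch \<open>0\<close> tends to \<open>-\<infinity>\<close> on the left, and the convention on continuing curves makes it return
from \<open>+\<infinity>\<close>. Continuity on the domain rules out that the point belongs to it.\<close>

lemma blow_up_if_label_0:
  assumes c: "c \<in> {1..n}" and i: "i \<in> {1..n}" and l: "label c (i - 1) = 0"
  shows "blows_up_at (b c) (A.zero i)" "A.zero i \<notin> D c"
proof -
  have i': "i - 1 \<le> n" using i by (meson atLeastAtMost_iff diff_le_self le_trans)
  have L: "filterlim (b c) at_bot (at_left (A.zero i))"
    using curve_left(1)[OF i label_le[OF c i'] b_label[OF c i']] l by blast
  then show "blows_up_at (b c) (A.zero i)" using b_blows[OF c i] by (simp add: blows_up_at_def)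
  show "A.zero i \<notin> D c"
  proof
    assume "A.zero i \<in> D c"
    then have "(b c \<longlongrightarrow> b c (A.zero i)) (at_left (A.zero i))" by (rule tendsto_b[OF c _ eventually_D[OF c]])
    then show False
      using not_tendsto_and_filterlim_at_infinity[OF trivial_limit_at_left_real]
        filterlim_mono[OF L at_bot_le_at_infinity order_refl] by blast
  qed
qed

text \<open>On any other branch the limit from the left is finite, and the curve is extended by it.\<close>

lemma extended_if_label_pos:
  assumes c: "c \<in> {1..n}" and i: "i \<in> {1..n}" and l: "label c (i - 1) \<noteq> 0"
  shows "A.zero i \<in> D c" "b c (A.zero i) = hB (label c (i - 1))" "\<not> blows_up_at (b c) (A.zero i)"
proof -
  have i': "i - 1 \<le> n" using i by (meson atLeastAtMost_iff diff_le_self le_trans)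
  have L: "(b c \<longlongrightarrow> hB (label c (i - 1))) (at_left (A.zero i))"
    using curve_left(2)[OF i label_le[OF c i'] b_label[OF c i']] l by blast
  from b_extends[OF c i this] show "A.zero i \<in> D c" "b c (A.zero i) = hB (label c (i - 1))" by auto
  show "\<not> blows_up_at (b c) (A.zero i)"
    unfolding blows_up_at_def
    using not_tendsto_and_filterlim_at_infinity[OF trivial_limit_at_left_real L]
      filterlim_mono[OF _ at_bot_le_at_infinity order_refl] by blast
qed

lemma ex1_blow_up:
  assumes i: "i \<in> {1..n}"
  shows "\<exists>!c. c \<in> {1..n} \<and> blows_up_at (b c) (A.zero i)"
proof -
  have iff: "c \<in> {1..n} \<and> blows_up_at (b c) (A.zero i) \<longleftrightarrow> c \<in> {1..n} \<and> label c (i - 1) = 0" for c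
    using blow_up_if_label_0(1)[OF _ i] extended_if_label_pos(3)[OF _ i] by blast
  have bij: "bij_betw (\<lambda>c. label c (i - 1)) {1..n} {..m}" 
      using i by (intro label_bij) (meson atLeastAtMost_iff diff_le_self le_trans)
  then have "0 \<in> (\<lambda>c. label c (i - 1)) ` {1..n}" by (simp add: bij_betw_def)
  then obtain c where c: "c \<in> {1..n}" "label c (i - 1) = 0" by auto
  show ?thesis unfolding iff
    using c bij_betw_imp_inj_on[OF bij] by (intro ex1I[of _ c]) (auto simp: inj_on_def)
qed

text \<open>Over an eigenvalue of \<open>A\<close> the pair-eigenvalues are the poles of \<open>B\<close>, and the curves on the branches
\<open>1, \<dots>, m\<close> end in exactly these.\<close>

lemma pair_eigenvalues_eq_curves:
  "{(s, t). pair_eigenvalue A B z \<kappa> (complex_of_real s, complex_of_real t)} = (\<Union>c\<in>{1..n}. curve (D c) (b c))"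
proof -
  have "pair_eigenvalue A B z \<kappa> (complex_of_real s, complex_of_real t) \<longleftrightarrow>
      (\<exists>c\<in>{1..n}. s \<in> D c \<and> t = b c s)" for s t
  proof (cases "s \<in> A.zero ` {1..n}")
    case True
    then obtain i where i: "i \<in> {1..n}" "s = A.zero i" by blast
    have bij: "bij_betw (\<lambda>c. label c (i - 1)) {1..n} {..m}" 
      using i by (intro label_bij) (meson atLeastAtMost_iff diff_le_self le_trans)
    have "pair_eigenvalue A B z \<kappa> (complex_of_real s, complex_of_real t) \<longleftrightarrow> (\<exists>k\<in>{..m}. k \<noteq> 0 \<and> t = hB k)"
    proof -
      have "{1..m} = {k \<in> {..m}. k \<noteq> 0}" by auto
      then show ?thesis unfolding pair_eigenvalue_iff_zero[OF True] by blast
    qed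
    also have "\<dots> \<longleftrightarrow> (\<exists>c\<in>{1..n}. label c (i - 1) \<noteq> 0 \<and> t = hB (label c (i - 1)))"
      unfolding bij_betw_imp_surj_on[OF bij, symmetric] by blast
    also have "\<dots> \<longleftrightarrow> (\<exists>c\<in>{1..n}. s \<in> D c \<and> t = b c s)"
      using blow_up_if_label_0(2)[OF _ i(1)] extended_if_label_pos(1,2)[OF _ i(1)] i(2) by metis
    finally show ?thesis .
  next
    case False
    have "pair_eigenvalue A B z \<kappa> (complex_of_real s, complex_of_real t) \<longleftrightarrow> t \<in> (\<lambda>k. B.branch k (\<tau> s)) ` {..m}"
      using pair_eigenvalue_iff_branch[OF False] by auto
    also have "\<dots> \<longleftrightarrow> (\<exists>c\<in>{1..n}. s \<in> D c \<and> t = b c s)"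
      unfolding bij_betw_imp_surj_on[OF b_bij[OF False], symmetric] using domain_off_spectrum[OF False] by blast
    finally show ?thesis .
  qed
  then show ?thesis by (auto simp: curve_def)
qed

lemma b_strict_antimono:
  assumes c: "c \<in> {1..n}" and I: "I \<subseteq> D c" "connected I"
  shows "strict_antimono_on I (b c)"
proof (rule monotone_onI)
  fix x y assume xy: "x \<in> I" "y \<in> I" "x < y"
  have sub: "{x..y} \<subseteq> D c" using connected_contains_Icc[OF I(2) xy(1,2)] I(1) by blast
  show "b c y < b c x"
  proof (rule decreasing_across_finite_set[where S = "A.zero ` {1..n}" and f = "b c" and x = x and y = y])
    show "continuous_on {x..y} (b c)" using continuous_on_subset[OF b_cont[OF c] sub] .
    fix u v assume uv: "x < u" "u < v" "v < y" "{u..v} \<inter> A.zero ` {1..n} = {}"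
    obtain i where i: "i \<le> n" "{u..v} \<subseteq> A.zero_gap i"
      using connected_avoid_subset_cell[OF connected_Icc uv(4) A.zero_strict_mono] .
    then have zero_gap: "u \<in> A.zero_gap i" "v \<in> A.zero_gap i" using uv by auto
    show "b c v < b c u"
      using B.branch_antimono[OF label_le[OF c i(1)] \<tau>_less[OF i(1) zero_gap uv(2)]] b_label[OF c i(1)] zero_gap by simp
  qed (use xy in auto)
qed

text \<open>Off both spectra \<open>\<tau>(a) \<noteq> 0\<close>, so \<open>a\<close> is not a pole and the derivative is
\<open>branch' * \<tau>' = (- 1 / W\<^sub>B) * \<kappa>\<^sup>2 W\<^sub>A / G\<^sub>A\<^sup>2\<close>; the resolvent formulas turn it into the slope.\<close>

lemma b_deriv:
  assumes c: "c \<in> {1..n}" and a: "a \<notin> A.zero ` {1..n}" and bz: "b c a \<notin> B.zero ` {1..n}"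
  shows "\<exists>d. complex_of_real d = slope A B z \<kappa> (complex_of_real a) (complex_of_real (b c a)) \<and>
    (b c has_real_derivative d) (at a) \<and> d < 0"
proof -
  define t where "t = b c a"
  obtain i where i: "i \<le> n" "a \<in> A.zero_gap i" using cell_cover[OF a] .
  define k where "k = label c i"
  have k: "k \<le> m" using label_le[OF c i(1)] by (simp add: k_def)
  have t: "t = B.branch k (\<tau> a)" using b_label[OF c i] by (simp add: k_def t_def)
  have tC: "t \<notin> hB ` {1..m}" using B.pole_gap_avoids_poles[OF k B.branch_in[OF k]] t by simp
  have Gt: "B.G t \<noteq> 0" using bz tC B.zero_iff by (auto simp: t_def)
  have GB: "B.G t = \<tau> a" using t B.G_branch[OF k] by simp
  have ah: "a \<notin> hA ` {1..m}" using Gt GB by (auto simp: \<tau>_def A.recip_def)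
  have Ga: "A.G a \<noteq> 0" using a ah A.zero_iff by blast
  define d where "d = - (\<kappa>\<^sup>2 * (A.W a / (A.G a)\<^sup>2) / B.W t)"
  have "(\<tau> has_real_derivative \<kappa>\<^sup>2 * (A.W a / (A.G a)\<^sup>2)) (at a)"
    unfolding \<tau>_def[abs_def] by (rule DERIV_cmult[OF A.recip_deriv[OF ah Ga]])
  from DERIV_chain2[OF B.branch_deriv[OF k] this]
  have d0: "((\<lambda>a. B.branch k (\<tau> a)) has_real_derivative d) (at a)"
    by (simp add: d_def t[symmetric] divide_inverse mult_ac)
  have ev: "\<forall>\<^sub>F x in nhds a. b c x = B.branch k (\<tau> x)"
    using eventually_nhds_in_open[OF open_cell i(2)]
    by (rule eventually_mono) (simp add: b_label[OF c i(1)] k_def)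
  have deriv: "(b c has_real_derivative d) (at a)"
    by (rule iffD2[OF DERIV_cong_ev[OF refl ev refl] d0])
  have "0 < \<kappa>\<^sup>2 * (A.W a / (A.G a)\<^sup>2) / B.W t"
    using \<kappa> Ga A.W_pos B.W_pos by simp
  then have "d < 0" by (simp add: d_def)
  have SA: "complex_of_real a \<notin> Spec A" using a A.Spec_iff_zero by blast
  have SB: "complex_of_real t \<notin> Spec B" using bz B.Spec_iff_zero t_def by blast
  have gB: "cinner (resolvent B t z) z = complex_of_real (inverse (B.G t))"
    using B.cinner_resolvent[OF SB, of 1] tC by (simp add: B.recip_def)
  have "slope A B z \<kappa> a t = complex_of_real (- (\<kappa>\<^sup>2 * (A.W a / (A.G a)\<^sup>2 * (inverse (B.G t))\<^sup>2)) / (B.W t / (B.G t)\<^sup>2))"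
    unfolding slope_def A.cinner_resolvent2[OF SA ah] B.cinner_resolvent2[OF SB tC] gB by simp
  also have "- (\<kappa>\<^sup>2 * (A.W a / (A.G a)\<^sup>2 * (inverse (B.G t))\<^sup>2)) / (B.W t / (B.G t)\<^sup>2) = d"
    using Gt by (simp add: d_def field_simps)
  finally show ?thesis using deriv \<open>d < 0\<close> by (auto simp: t_def)
qed

end
end

theorem theorem2p3:
  fixes A B :: "'a::complex_hilbert \<Rightarrow> 'a"
    and z :: 'a and \<kappa> :: real and n :: nat
    and \<alpha> \<beta> \<alpha>h \<beta>h :: "nat \<Rightarrow> real" and x y :: "nat \<Rightarrow> ereal"
  assumes findim: "\<exists>S. finite S \<and> cspan S = (UNIV :: 'a set)"
    and dim: "cdim (UNIV :: 'a set) = n"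
    and A: "selfadjoint A" and B: "selfadjoint B"
    and \<alpha>: "ordered_eigenvalues UNIV A n \<alpha>"
    and \<beta>: "ordered_eigenvalues UNIV B n \<beta>"
    and z: "norm z = 1" and \<kappa>: "\<kappa> \<noteq> 0"
    and \<alpha>h: "ordered_eigenvalues (Zperp z) (compression z A) (n - 1) \<alpha>h"
    and \<beta>h: "ordered_eigenvalues (Zperp z) (compression z B) (n - 1) \<beta>h"
    and \<Gamma>A: "Gam z A = {}" and \<Gamma>B: "Gam z B = {}"
  defines "x \<equiv> grid n \<alpha> \<alpha>h" and "y \<equiv> grid n \<beta> \<beta>h"
  shows "(\<exists>D b. eigenvalue_curves A B z \<kappa> n D b) \<and>
    (\<forall>D b. eigenvalue_curves A B z \<kappa> n D b \<longrightarrow>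
      {(s, t). pair_eigenvalue A B z \<kappa> (complex_of_real s, complex_of_real t)}
        = (\<Union>c\<in>{1..n}. curve (D c) (b c)) \<and>
      \<comment> \<open>(a)\<close>
      (\<forall>c\<in>{1..n}. \<forall>p\<in>{1..2*n}. \<forall>q\<in>{1..2*n}.
         curve (D c) (b c) \<inter> rectangle x y p q \<noteq> {} \<longrightarrow> even (p + q)) \<and>
      \<comment> \<open>(b)\<close>
      (\<forall>c\<in>{1..n}. \<forall>(s, t) \<in> curve (D c) (b c).
         (s, t) \<notin> (\<Union>p\<in>{1..2*n}. \<Union>q\<in>{1..2*n}. rectangle x y p q) \<longrightarrow>
         (\<exists>i\<le>2*n. \<exists>j\<le>2*n. odd (i + j) \<and> ereal s = x i \<and> ereal t = y j)) \<and>
      \<comment> \<open>(c)\<close>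
      (\<forall>c\<in>{1..n}. \<forall>a. complex_of_real a \<notin> Spec A \<longrightarrow> a \<in> D c \<and> isCont (b c) a) \<and>
      (\<forall>i\<in>{1..n}.
         (\<exists>!c. c \<in> {1..n} \<and> blows_up_at (b c) (\<alpha> i)) \<and>
         (\<forall>c\<in>{1..n}. \<not> blows_up_at (b c) (\<alpha> i) \<longrightarrow> \<alpha> i \<in> D c \<and> isCont (b c) (\<alpha> i))) \<and>
      \<comment> \<open>(d)\<close>
      (\<forall>c\<in>{1..n}. \<forall>I. I \<subseteq> D c \<and> connected I \<longrightarrow> strict_antimono_on I (b c)) \<and>
      (\<forall>c\<in>{1..n}. \<forall>a. complex_of_real a \<notin> Spec A \<and> complex_of_real (b c a) \<notin> Spec B \<longrightarrow>
         (\<exists>d. complex_of_real d = slope A B z \<kappa> (complex_of_real a) (complex_of_real (b c a)) \<and>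
              (b c has_real_derivative d) (at a) \<and> d < 0)))"
proof -
  \<comment> \<open>A unit vector exists, so the dimension is positive, as the index \<open>m = n - 1\<close> requires.\<close>
  have "card {z} \<le> cdim (UNIV :: 'a set)"
    by (rule card_orthogonal_le_cdim[OF findim]) (use z in auto)
  then obtain m where n: "n = Suc m" using dim by (cases n) auto
  have dim': "cdim (UNIV :: 'a set) \<le> Suc m" using dim n by simp
  obtain \<psi>A \<sigma>A cA where "bordered A z m \<alpha>h \<psi>A \<sigma>A cA"
    using bordered_exists[OF findim dim' A z _ \<Gamma>A, of \<alpha>h] \<alpha>h n by auto
  moreover obtain \<psi>B \<sigma>B cB where "bordered B z m \<beta>h \<psi>B \<sigma>B cB"
    using bordered_exists[OF findim dim' B z _ \<Gamma>B, of \<beta>h] \<beta>h n by auto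
  ultimately interpret coupled A B z m \<alpha>h \<beta>h \<psi>A \<psi>B \<sigma>A \<sigma>B cA cB \<kappa>
    using \<kappa> by (simp add: coupled_def coupled_axioms_def)
  have \<alpha>_eq: "\<alpha> j = A.zero j" if "j \<in> {1..Suc m}" for j
    using A.ordered_eigenvalues_eq_zero[OF _ that] \<alpha> n by simp
  have \<beta>_eq: "\<beta> j = B.zero j" if "j \<in> {1..Suc m}" for j
    using B.ordered_eigenvalues_eq_zero[OF _ that] \<beta> n by simp
  have pair: "pair_eigenvalue A B z \<kappa> (complex_of_real s, complex_of_real t)"
    if "eigenvalue_curves A B z \<kappa> (Suc m) D b" "c \<in> {1..Suc m}" "(s, t) \<in> curve (D c) (b c)" for D b c s t
    using pair_eigenvalues_eq_curves[OF that(1)] that(2,3) by blast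
  show ?thesis
    unfolding n x_def y_def
  proof (intro conjI allI impI ballI)
    show "\<exists>D b. eigenvalue_curves A B z \<kappa> (Suc m) D b" using eigenvalue_curves_exist by blast
  next
    fix D b assume curves: "eigenvalue_curves A B z \<kappa> (Suc m) D b"
    show "{(s, t). pair_eigenvalue A B z \<kappa> (complex_of_real s, complex_of_real t)} = (\<Union>c\<in>{1..Suc m}. curve (D c) (b c))"
      by (rule pair_eigenvalues_eq_curves[OF curves])
    show "even (p + q)" if "c \<in> {1..Suc m}" "p \<in> {1..2 * Suc m}" "q \<in> {1..2 * Suc m}"
      "curve (D c) (b c) \<inter> rectangle (grid (Suc m) \<alpha> \<alpha>h) (grid (Suc m) \<beta> \<beta>h) p q \<noteq> {}" for c p q
      using pair_eigenvalue_rectangle[OF \<alpha>_eq \<beta>_eq pair[OF curves that(1)] that(2,3)] that(4) by fastforce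
    show "case st of (s, t) \<Rightarrow>
         (s, t) \<notin> (\<Union>p\<in>{1..2*Suc m}. \<Union>q\<in>{1..2*Suc m}. rectangle (grid (Suc m) \<alpha> \<alpha>h) (grid (Suc m) \<beta> \<beta>h) p q) \<longrightarrow>
         (\<exists>i\<le>2*Suc m. \<exists>j\<le>2*Suc m. odd (i + j) \<and> ereal s = grid (Suc m) \<alpha> \<alpha>h i \<and> ereal t = grid (Suc m) \<beta> \<beta>h j)"
      if "c \<in> {1..Suc m}" "st \<in> curve (D c) (b c)" for c st
      using pair_eigenvalue_corner[OF \<alpha>_eq \<beta>_eq pair[OF curves that(1)]] that(2) by (cases st) blast
    show "a \<in> D c" "isCont (b c) a" if "c \<in> {1..Suc m}" "complex_of_real a \<notin> Spec A" for c a
      using domain_off_spectrum[OF curves _ that(1)] b_isCont[OF curves that(1)] that(2) A.Spec_iff_zero by blast+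
    fix i assume i: "i \<in> {1..Suc m}"
    show "\<exists>!c. c \<in> {1..Suc m} \<and> blows_up_at (b c) (\<alpha> i)"
      unfolding \<alpha>_eq[OF i] by (rule ex1_blow_up[OF curves i])
    show "\<alpha> i \<in> D c" "isCont (b c) (\<alpha> i)" if "c \<in> {1..Suc m}" "\<not> blows_up_at (b c) (\<alpha> i)" for c
      using that blow_up_if_label_0(1)[OF curves that(1) i] extended_if_label_pos(1)[OF curves that(1) i] b_isCont[OF curves that(1)]
      unfolding \<alpha>_eq[OF i] by blast+
  next
    fix D b c assume curves: "eigenvalue_curves A B z \<kappa> (Suc m) D b" and c: "c \<in> {1..Suc m}"
    show "strict_antimono_on I (b c)" if "I \<subseteq> D c \<and> connected I" for I
      using b_strict_antimono[OF curves c] that by blast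
    show "\<exists>d. complex_of_real d = slope A B z \<kappa> (complex_of_real a) (complex_of_real (b c a)) \<and>
        (b c has_real_derivative d) (at a) \<and> d < 0"
      if "complex_of_real a \<notin> Spec A \<and> complex_of_real (b c a) \<notin> Spec B" for a
      using b_deriv[OF curves c, of a] that A.Spec_iff_zero B.Spec_iff_zero by blast
  qed
qed

end
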